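(* There exist sequences $(x_n)_{n \geq 1}$ in $[0,1)$ such that both of the following hold: (1) the star-discrepancy satisfies $D_N^*(x_1,\dots,x_N) = O\left(\frac{\log N}{N}\right)$, i.e. there is a constant $C>0$ with $D_N^*(x_1,\dots,x_N) \le C\,\frac{\log N}{N}$ for all $N \geq 2$; and (2) $(x_n)_{n\ge 1}$ has Poissonian pair correlation, i.e. for every fixed real $s>0$, $R_{s,N}(x_1,\dots,x_N) \to 2s$ as $N \to \infty$.
   Context: For a sequence $(x_n)_{n\ge1}$ in $[0,1)$ and $N \ge 1$, the star-discrepancy is $$D_N^*(x_1,\dots,x_N) = \sup_{a\in[0,1)} \left| \frac1N \sum_{n=1}^N \mathbf{1}_{[0,a)}(x_n) - a \right|.$$ The pair correlation statistic is, for real $s>0$, $$R_{s,N}(x_1,\dots,x_N) = \frac1N \#\left\{ (n,m) : 1 \le n \ne m \le N,\ \|x_n - x_m\| \le \frac sN \right\},$$ where $\|\cdot\|$ denotes the distance to the nearest integer. *)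

theory Defs
  imports "HOL-Analysis.Analysis"
begin

text \<open>
  Sequences \<open>(x_n)\<close> with \<open>n \<ge> 1\<close> are functions \<open>nat \<Rightarrow> real\<close> whose value at \<open>0\<close> is never used.
\<close>

text \<open>The set of deviations is bounded by \<open>1\<close> (see \<open>bdd_above_discrepancy\<close>), so the supremum
  is a genuine one.\<close>

definition star_discrepancy :: "(nat \<Rightarrow> real) \<Rightarrow> nat \<Rightarrow> real" where
  "star_discrepancy x N =
     (SUP a\<in>{0..<1}. \<bar>1 / real N * (\<Sum>n=1..N. indicator {0..<a} (x n)) - a\<bar>)"

lemma bdd_above_discrepancy:
  fixes x :: "nat \<Rightarrow> real"
  shows "bdd_above ((\<lambda>a. \<bar>1 / real N * (\<Sum>n=1..N. indicator {0..<a} (x n)) - a\<bar>) ` {0..<1})"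
proof (rule bdd_aboveI2)
  fix a :: real assume a: "a \<in> {0..<1}"
  let ?S = "(\<Sum>n=1..N. indicator {0..<a} (x n)) :: real"
  have "?S \<le> (\<Sum>n=1..N. 1)"
    by (intro sum_mono) (simp add: indicator_def)
  then have "1 / real N * ?S \<le> 1"
    by (simp add: divide_simps)
  moreover have "0 \<le> 1 / real N * ?S"
    by (simp add: sum_nonneg)
  ultimately show "\<bar>1 / real N * ?S - a\<bar> \<le> 1"
    using a by auto
qed

definition dist_nearest_int :: "real \<Rightarrow> real" where
  "dist_nearest_int t = infdist t \<int>"

definition pair_correlation :: "real \<Rightarrow> (nat \<Rightarrow> real) \<Rightarrow> nat \<Rightarrow> real" where
  "pair_correlation s x N =
     1 / real N * real (card {(n, m). n \<in> {1..N} \<and> m \<in> {1..N} \<and> n \<noteq> m \<and>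
                                      dist_nearest_int (x n - x m) \<le> s / real N})"

definition poissonian_pair_correlation :: "(nat \<Rightarrow> real) \<Rightarrow> bool" where
  "poissonian_pair_correlation x \<longleftrightarrow>
     (\<forall>s>0. (\<lambda>N. pair_correlation s x N) \<longlonglongrightarrow> 2 * s)"

end

theory Submission
  imports Defs "HOL-Real_Asymp.Real_Asymp"
begin

text \<open>
Poissonian pair correlation forces the number of points in an interval of length \<open>s / N\<close> to
fluctuate with a variance of order \<open>s\<close>, so a lattice-like point set is too regular for it; independent
random points, on the other hand, have a discrepancy far above \<open>log N / N\<close>.  The construction
uses randomness at a scale only slightly larger than \<open>1 / N\<close> and exact regularity at every larger scale.

The sequence is a concatenation of blocks, and each block is chosen with all earlier points fixed.
Let \<open>N\<close> points be given.  A block with parameter \<open>q\<close> divides the unit interval into \<open>m\<close> cells,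
where \<open>m\<close> is about \<open>N / 4\<^sup>q\<close>, and attaches to each cell \<open>c\<close> and each \<open>l < q\<close> an
independent uniform shift \<open>w (c, l)\<close>.  It consists of passes \<open>(i, l)\<close> with \<open>i < K = 2 ^ (3 q + 1)\<close>
and \<open>l < q\<close>, in lexicographic order; a pass puts one point into every cell, at the relative position
\<open>v\<^sub>i + w (c, l)\<close> modulo \<open>1\<close>, where \<open>v\<close> is the van der Corput sequence.  Inside a pass the cells
are visited in bit-reversed order.

Discrepancy (\<open>prefix_discrepancy\<close>, \<open>complete_discrepancy\<close>).  A pass only errs in the cell that
contains the end point of the test interval.  For fixed \<open>l\<close> the \<open>K\<close> points of one cell form a shifted
lattice, so a complete block has counting error at most \<open>q\<close>; as it multiplies the number of points by at
least \<open>2\<^sup>q\<close>, the errors of all complete blocks add up to \<open>O(log N)\<close>.  The unfinished block contributes at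
most \<open>q K\<close>, which is below \<open>log N\<close> if \<open>q\<close> grows slowly, and the unfinished pass contributes
\<open>O(log m)\<close> by the discrepancy of bit reversal.

Pair correlation (\<open>new_pairs_concentration\<close>, \<open>block_pair_error\<close>).  Each new point is uniform in its
cell, so the expected density of each pass is constant, and the expected number of close pairs of an old point and a
pass is that of \<open>m\<close> uniform points, wherever the old point lies.  Two new points with different index
\<open>(c, l)\<close> are independent.  Points with the same index are kept so far apart by bit reversal that they never form a
close pair (\<open>shift_separation\<close>); the close pairs that are missing for this reason would make up a proportion of at
most \<open>1 / q\<close>.  Changing one shift moves few points, each with few neighbours, so a
second-moment bound (\<open>bounded_difference_variance\<close>) shows that some choice of the shifts is close to its mean
for all relevant times and distances at once.  Times between the ends of chunks of \<open>q\<close> passes are covered by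
the monotonicity of the number of pairs.

Hence the relative error of the pair count is at least halved by the growth of a block and receives a new
contribution \<open>O(1 / q)\<close> (\<open>chained_blocks_pair_error\<close>).  It tends to \<open>0\<close> since \<open>q\<close> tends to infinity.
All points lie on dyadic grids, so that all probabilities are averages over finite sets.
\<close>

section \<open>Concentration on finite product spaces\<close>

definition avg :: "'a set \<Rightarrow> ('a \<Rightarrow> real) \<Rightarrow> real" where
  "avg S f = (\<Sum>x\<in>S. f x) / real (card S)"

lemma avg_sum: "avg S (\<lambda>x. \<Sum>i\<in>I. f i x) = (\<Sum>i\<in>I. avg S (f i))"
  unfolding avg_def by (subst sum.swap) (simp add: sum_divide_distrib)

lemma avg_add: "avg S (\<lambda>x. f x + g x) = avg S f + avg S g"
  unfolding avg_def by (simp add: sum.distrib add_divide_distrib)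

lemma avg_mult_left: "avg S (\<lambda>x. k * f x) = k * avg S f"
  unfolding avg_def by (simp add: sum_distrib_left)

lemma avg_cong: "(\<And>x. x \<in> S \<Longrightarrow> f x = g x) \<Longrightarrow> avg S f = avg S g"
  unfolding avg_def by (simp cong: sum.cong)

lemma avg_mono: "(\<And>x. x \<in> S \<Longrightarrow> f x \<le> g x) \<Longrightarrow> avg S f \<le> avg S g"
  unfolding avg_def by (intro divide_right_mono sum_mono) auto

lemma avg_const: "finite S \<Longrightarrow> S \<noteq> {} \<Longrightarrow> avg S (\<lambda>_. c) = c"
  unfolding avg_def by simp

lemma avg_abs_diff_le:
  assumes "finite S" "S \<noteq> {}" "\<And>x. x \<in> S \<Longrightarrow> \<bar>f x - g x\<bar> \<le> D"
  shows "\<bar>avg S f - avg S g\<bar> \<le> D"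
proof -
  have c: "real (card S) > 0" using assms by (simp add: card_gt_0_iff)
  have "avg S f - avg S g = avg S (\<lambda>x. f x - g x)"
    by (simp add: avg_def sum_subtractf diff_divide_distrib)
  also have "\<bar>\<dots>\<bar> \<le> (\<Sum>x\<in>S. \<bar>f x - g x\<bar>) / real (card S)"
    unfolding avg_def by (simp add: divide_right_mono)
  also have "\<dots> \<le> (real (card S) * D) / real (card S)"
    by (intro divide_right_mono sum_bounded_above assms) auto
  finally show ?thesis using c by simp
qed

text \<open>
The bias-variance decomposition: the mean square around \<open>c\<close> splits into the variance and the squared
distance of \<open>c\<close> from the mean.
\<close>

lemma sum_sq_decomp:
  assumes "finite S" "S \<noteq> {}"
  shows "(\<Sum>x\<in>S. (f x - c)\<^sup>2) = (\<Sum>x\<in>S. (f x - avg S f)\<^sup>2) + real (card S) * (avg S f - c)\<^sup>2"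
proof -
  have c: "real (card S) > 0" using assms by (simp add: card_gt_0_iff)
  define M where "M = avg S f"
  have s: "(\<Sum>x\<in>S. f x) = real (card S) * M" using c by (simp add: M_def avg_def)
  have "(\<Sum>x\<in>S. (f x - c)\<^sup>2) = (\<Sum>x\<in>S. (f x - M)\<^sup>2 + 2 * (M - c) * f x - 2 * (M - c) * M + (M - c)\<^sup>2)"
    by (rule sum.cong) (auto simp: power2_eq_square algebra_simps)
  also have "\<dots> = (\<Sum>x\<in>S. (f x - M)\<^sup>2) + 2 * (M - c) * (\<Sum>x\<in>S. f x)
      - real (card S) * (2 * (M - c) * M) + real (card S) * (M - c)\<^sup>2"
    by (simp add: sum.distrib sum_subtractf sum_distrib_left)
  finally show ?thesis by (simp add: s M_def)
qed

lemma sum_PiE_insert: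
  assumes "a \<notin> A"
  shows "(\<Sum>w\<in>PiE (insert a A) (\<lambda>_. V). F w) = (\<Sum>v\<in>V. \<Sum>w\<in>PiE A (\<lambda>_. V). F (w(a := v)))"
proof -
  have "(\<Sum>w\<in>PiE (insert a A) (\<lambda>_. V). F w) =
      (\<Sum>(v, w)\<in>V \<times> PiE A (\<lambda>_. V). F (w(a := v)))"
    unfolding PiE_insert_eq
    by (subst sum.reindex) (use inj_combinator[OF assms, of "\<lambda>_. V"] in \<open>auto simp: case_prod_unfold\<close>)
  then show ?thesis by (simp add: sum.cartesian_product)
qed

lemma avg_PiE_insert:
  assumes "a \<notin> A" "finite A"
  shows "avg (PiE (insert a A) (\<lambda>_. V)) F = avg (PiE A (\<lambda>_. V)) (\<lambda>w. avg V (\<lambda>v. F (w(a := v))))"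
proof -
  have "card (PiE (insert a A) (\<lambda>_. V)) = card V * card (PiE A (\<lambda>_. V))"
    using assms by (simp add: card_PiE)
  then show ?thesis
    unfolding avg_def sum_PiE_insert[OF assms(1)]
    by (subst sum.swap) (simp add: sum_divide_distrib)
qed

lemma avg_PiE_component:
  assumes "finite A" "a \<in> A" "finite V" "V \<noteq> {}"
  shows "avg (PiE A (\<lambda>_. V)) (\<lambda>w. \<phi> (w a)) = avg V \<phi>"
proof -
  have A: "A = insert a (A - {a})" using assms by auto
  have "PiE (A - {a}) (\<lambda>_. V) \<noteq> {}" using assms by (simp add: PiE_eq_empty_iff)
  moreover have "finite (PiE (A - {a}) (\<lambda>_. V))" using assms by (intro finite_PiE) auto
  ultimately show ?thesis
    using assms by (subst A, subst avg_PiE_insert) (auto simp: avg_const)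
qed

lemma avg_PiE_two_components:
  assumes "finite A" "a \<in> A" "b \<in> A" "a \<noteq> b" "finite V" "V \<noteq> {}"
  shows "avg (PiE A (\<lambda>_. V)) (\<lambda>w. \<psi> (w a) (w b)) = avg V (\<lambda>v. avg V (\<lambda>u. \<psi> u v))"
proof -
  have A: "A = insert a (A - {a})" using assms by auto
  have "avg (PiE A (\<lambda>_. V)) (\<lambda>w. \<psi> (w a) (w b)) =
     avg (PiE (A - {a}) (\<lambda>_. V)) (\<lambda>w. avg V (\<lambda>u. \<psi> u (w b)))"
    using assms by (subst A, subst avg_PiE_insert) auto
  also have "\<dots> = avg V (\<lambda>v. avg V (\<lambda>u. \<psi> u v))"
    using assms by (intro avg_PiE_component) auto
  finally show ?thesis .
qed

text \<open>
A weak form of the Efron--Stein inequality.  Averaging over one coordinate leaves a function of the others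
with the same mean and the same bounds on its differences, and by \<open>sum_sq_decomp\<close> it lowers the variance by at most
\<open>D\<^sup>2\<close>; induction on the number of coordinates does the rest.
\<close>

lemma bounded_difference_variance:
  fixes f :: "('a \<Rightarrow> 'b) \<Rightarrow> real"
  assumes "finite A" "finite V" "V \<noteq> {}"
    and "\<And>w a v. w \<in> PiE A (\<lambda>_. V) \<Longrightarrow> a \<in> A \<Longrightarrow> v \<in> V \<Longrightarrow> \<bar>f (w(a := v)) - f w\<bar> \<le> D"
  shows "avg (PiE A (\<lambda>_. V)) (\<lambda>w. (f w - avg (PiE A (\<lambda>_. V)) f)\<^sup>2) \<le> real (card A) * D\<^sup>2"
  using assms
proof (induction A arbitrary: f rule: finite_induct)
  case empty
  then show ?case by (simp add: avg_def)
next
  case (insert a A)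
  let ?O = "PiE A (\<lambda>_. V)" and ?O' = "PiE (insert a A) (\<lambda>_. V)"
  define g where "g w = avg V (\<lambda>v. f (w(a := v)))" for w
  have V: "finite V" "V \<noteq> {}" using insert.prems by auto
  have O: "finite ?O" "?O \<noteq> {}" using insert by (auto simp: PiE_eq_empty_iff intro!: finite_PiE)
  have upd: "w(a := v) \<in> ?O'" if "w \<in> ?O" "v \<in> V" for w v
    using that insert.hyps by (auto simp: PiE_insert_eq)
  have M: "avg ?O' f = avg ?O g"
    unfolding g_def using insert.hyps by (intro avg_PiE_insert) auto
  have gdiff: "\<bar>g (w(b := v)) - g w\<bar> \<le> D" if "w \<in> ?O" "b \<in> A" "v \<in> V" for w b v
    unfolding g_def
  proof (rule avg_abs_diff_le[OF V])
    fix u assume u: "u \<in> V"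
    have "a \<noteq> b" using that insert.hyps by auto
    then have "(w(b := v))(a := u) = (w(a := u))(b := v)" by (auto simp: fun_eq_iff)
    moreover have "\<bar>f ((w(a := u))(b := v)) - f (w(a := u))\<bar> \<le> D"
      using that by (intro insert.prems(3) upd u) auto
    ultimately show "\<bar>f ((w(b := v))(a := u)) - f (w(a := u))\<bar> \<le> D"
      by metis
  qed
  have inner: "avg V (\<lambda>v. (f (w(a := v)) - avg ?O' f)\<^sup>2) \<le> D\<^sup>2 + (g w - avg ?O g)\<^sup>2" if w: "w \<in> ?O" for w
  proof -
    have c: "real (card V) > 0" using V by (simp add: card_gt_0_iff)
    have "\<bar>f (w(a := v)) - g w\<bar> \<le> D" if v: "v \<in> V" for v
    proof -
      have "\<bar>avg V (\<lambda>_. f (w(a := v))) - g w\<bar> \<le> D"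
        unfolding g_def
      proof (rule avg_abs_diff_le[OF V])
        fix u assume u: "u \<in> V"
        have "\<bar>f ((w(a := u))(a := v)) - f (w(a := u))\<bar> \<le> D"
          using v by (intro insert.prems(3) upd[OF w u]) auto
        then show "\<bar>f (w(a := v)) - f (w(a := u))\<bar> \<le> D"
          by (metis fun_upd_upd)
      qed
      then show ?thesis using V by (simp add: avg_const)
    qed
    then have "(f (w(a := v)) - g w)\<^sup>2 \<le> D\<^sup>2" if "v \<in> V" for v
      using that by (metis abs_le_square_iff abs_of_nonneg abs_ge_zero order_trans)
    then have "(\<Sum>v\<in>V. (f (w(a := v)) - g w)\<^sup>2) \<le> real (card V) * D\<^sup>2"
      by (intro sum_bounded_above) auto
    then have "(\<Sum>v\<in>V. (f (w(a := v)) - avg ?O' f)\<^sup>2) \<le> real (card V) * (D\<^sup>2 + (g w - avg ?O g)\<^sup>2)"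
      using sum_sq_decomp[OF V, of "\<lambda>v. f (w(a := v))" "avg ?O' f"]
      unfolding M g_def[symmetric] by (simp add: algebra_simps)
    then show ?thesis using c unfolding avg_def[of V] by (simp add: field_simps)
  qed
  have "avg ?O' (\<lambda>w. (f w - avg ?O' f)\<^sup>2) = avg ?O (\<lambda>w. avg V (\<lambda>v. (f (w(a := v)) - avg ?O' f)\<^sup>2))"
    using insert.hyps by (intro avg_PiE_insert) auto
  also have "\<dots> \<le> avg ?O (\<lambda>w. D\<^sup>2 + (g w - avg ?O g)\<^sup>2)"
    by (intro avg_mono inner)
  also have "\<dots> = D\<^sup>2 + avg ?O (\<lambda>w. (g w - avg ?O g)\<^sup>2)"
    using O by (simp add: avg_add avg_const)
  also have "\<dots> \<le> D\<^sup>2 + real (card A) * D\<^sup>2"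
    using insert.IH[OF V gdiff] by simp
  also have "\<dots> = real (card (insert a A)) * D\<^sup>2"
    using insert.hyps by (simp add: algebra_simps)
  finally show ?case .
qed

text \<open>
The sum of the variances of all the test functions bounds the average of the sum of their squared deviations, so some
point \<open>w\<close> does not exceed that average.
\<close>

lemma simultaneous_concentration:
  fixes f :: "'t \<Rightarrow> ('a \<Rightarrow> 'b) \<Rightarrow> real"
  assumes "finite A" "finite V" "V \<noteq> {}" "finite T"
    and "\<And>\<tau> w a v. \<tau> \<in> T \<Longrightarrow> w \<in> PiE A (\<lambda>_. V) \<Longrightarrow> a \<in> A \<Longrightarrow> v \<in> V \<Longrightarrow> \<bar>f \<tau> (w(a := v)) - f \<tau> w\<bar> \<le> D"
  shows "\<exists>w\<in>PiE A (\<lambda>_. V). \<forall>\<tau>\<in>T. (f \<tau> w - avg (PiE A (\<lambda>_. V)) (f \<tau>))\<^sup>2 \<le> real (card T) * real (card A) * D\<^sup>2"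
proof -
  let ?O = "PiE A (\<lambda>_. V)"
  define B where "B = real (card T) * real (card A) * D\<^sup>2"
  define G where "G w = (\<Sum>\<tau>\<in>T. (f \<tau> w - avg ?O (f \<tau>))\<^sup>2)" for w
  have O: "finite ?O" "?O \<noteq> {}" using assms by (auto simp: PiE_eq_empty_iff intro!: finite_PiE)
  have "avg ?O G \<le> (\<Sum>\<tau>\<in>T. real (card A) * D\<^sup>2)"
    unfolding G_def avg_sum using assms by (intro sum_mono bounded_difference_variance) auto
  then have le: "avg ?O G \<le> B" by (simp add: B_def)
  have "\<exists>w\<in>?O. G w \<le> B"
  proof (rule ccontr)
    assume "\<not> ?thesis"
    then have "(\<Sum>w\<in>?O. B) < (\<Sum>w\<in>?O. G w)" using O by (intro sum_strict_mono) auto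
    moreover have "real (card ?O) > 0" using O card_gt_0_iff by fastforce
    ultimately have "B < avg ?O G" unfolding avg_def by (simp add: field_simps)
    with le show False by simp
  qed
  then obtain w where w: "w \<in> ?O" "G w \<le> B" by blast
  have "(f \<tau> w - avg ?O (f \<tau>))\<^sup>2 \<le> B" if "\<tau> \<in> T" for \<tau>
  proof -
    have "(f \<tau> w - avg ?O (f \<tau>))\<^sup>2 \<le> G w"
      unfolding G_def by (rule member_le_sum[OF that]) (use assms in auto)
    with w show ?thesis by simp
  qed
  with w show ?thesis unfolding B_def by blast
qed

text \<open>
The coordinate \<open>a\<close> enters only through one summand \<open>\<phi> a\<close> and, in both orders, through the pairs that
contain \<open>a\<close>; everything else cancels in the difference.
\<close>

lemma pair_functional_bounded_difference:
  fixes \<phi> :: "'a \<Rightarrow> 'b \<Rightarrow> real" and \<psi> :: "'a \<Rightarrow> 'a \<Rightarrow> 'b \<Rightarrow> 'b \<Rightarrow> real"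
  assumes "finite A" "a \<in> A" "u \<in> V" and w: "w \<in> PiE A (\<lambda>_. V)"
    and sym: "\<And>a b u v. \<psi> a b u v = \<psi> b a v u"
    and \<phi>: "\<And>u. u \<in> V \<Longrightarrow> 0 \<le> \<phi> a u \<and> \<phi> a u \<le> \<Phi>"
    and \<psi>: "\<And>u. u \<in> V \<Longrightarrow> 0 \<le> (\<Sum>b\<in>A - {a}. \<psi> a b u (w b)) \<and> (\<Sum>b\<in>A - {a}. \<psi> a b u (w b)) \<le> \<Psi>"
  defines "f \<equiv> \<lambda>w. (\<Sum>x\<in>A. \<phi> x (w x)) + (\<Sum>x\<in>A. \<Sum>y\<in>A - {x}. \<psi> x y (w x) (w y))"
  shows "\<bar>f (w(a := u)) - f w\<bar> \<le> \<Phi> + 2 * \<Psi>"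
proof -
  \<comment> \<open>the part that does not involve the coordinate \<open>a\<close>\<close>
  define R where "R w = (\<Sum>x\<in>A - {a}. \<phi> x (w x)) + (\<Sum>x\<in>A - {a}. \<Sum>y\<in>A - {a} - {x}. \<psi> x y (w x) (w y))" for w
  have dec: "f w = \<phi> a (w a) + 2 * (\<Sum>b\<in>A - {a}. \<psi> a b (w a) (w b)) + R w" for w
  proof -
    have "(\<Sum>x\<in>A. \<Sum>y\<in>A - {x}. \<psi> x y (w x) (w y)) =
        (\<Sum>y\<in>A - {a}. \<psi> a y (w a) (w y)) + (\<Sum>x\<in>A - {a}. \<Sum>y\<in>A - {x}. \<psi> x y (w x) (w y))"
      using assms by (subst sum.remove[of A a]) auto
    also have "(\<Sum>x\<in>A - {a}. \<Sum>y\<in>A - {x}. \<psi> x y (w x) (w y)) =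
        (\<Sum>x\<in>A - {a}. \<psi> x a (w x) (w a) + (\<Sum>y\<in>A - {a} - {x}. \<psi> x y (w x) (w y)))"
    proof (rule sum.cong[OF refl])
      fix x assume x: "x \<in> A - {a}"
      have "A - {x} - {a} = A - {a} - {x}" by auto
      then show "(\<Sum>y\<in>A - {x}. \<psi> x y (w x) (w y)) = \<psi> x a (w x) (w a) + (\<Sum>y\<in>A - {a} - {x}. \<psi> x y (w x) (w y))"
        using assms x by (subst sum.remove[of "A - {x}" a]) auto
    qed
    also have "\<dots> = (\<Sum>y\<in>A - {a}. \<psi> a y (w a) (w y)) + (\<Sum>x\<in>A - {a}. \<Sum>y\<in>A - {a} - {x}. \<psi> x y (w x) (w y))"
      by (simp add: sum.distrib sym[of _ a])
    finally show ?thesis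
      using assms(1,2) unfolding f_def R_def by (simp add: sum.remove[of A a])
  qed
  have Req: "R (w(a := u)) = R w"
    unfolding R_def by (intro arg_cong2[of _ _ _ _ "(+)"] sum.cong) auto
  have S: "(\<Sum>b\<in>A - {a}. \<psi> a b ((w(a := u)) a) ((w(a := u)) b)) = (\<Sum>b\<in>A - {a}. \<psi> a b u (w b))"
    by (rule sum.cong) auto
  have "w a \<in> V" using w assms(2) by auto
  then show ?thesis
    using \<phi>[of u] \<phi>[of "w a"] \<psi>[of u] \<psi>[of "w a"] assms(3)
    unfolding dec Req S by (auto simp: abs_le_iff)
qed

section \<open>Bit reversal\<close>

text \<open>
The reversal of the \<open>r\<close> binary digits of \<open>i\<close>, so that \<open>bitrev r i / 2 ^ r\<close> is the van der Corput
sequence.  The recursion splits off the leading digit of \<open>i\<close>, which becomes the last digit of the result.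
\<close>

fun bitrev :: "nat \<Rightarrow> nat \<Rightarrow> nat" where
  "bitrev 0 i = 0"
| "bitrev (Suc r) i = (if i < 2 ^ r then 2 * bitrev r i else 2 * bitrev r (i - 2 ^ r) + 1)"

lemma bitrev_less: "i < 2 ^ r \<Longrightarrow> bitrev r i < 2 ^ r"
proof (induction r arbitrary: i)
  case (Suc r)
  show ?case
  proof (cases "i < 2 ^ r")
    case True
    with Suc.IH[of i] show ?thesis by simp
  next
    case False
    with Suc.prems have "i - 2 ^ r < 2 ^ r" by auto
    with Suc.IH[OF this] False show ?thesis by simp
  qed
qed simp

lemma bitrev_inj: "i < 2 ^ r \<Longrightarrow> j < 2 ^ r \<Longrightarrow> bitrev r i = bitrev r j \<Longrightarrow> i = j"
proof (induction r arbitrary: i j)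
  case (Suc r)
  have par: "2 * a \<noteq> 2 * b + (1::nat)" "2 * a + (1::nat) \<noteq> 2 * b" for a b by presburger+
  show ?case
  proof (cases "i < 2 ^ r")
    case i: True
    show ?thesis
    proof (cases "j < 2 ^ r")
      case True
      with i Suc show ?thesis by auto
    next
      case False
      with i Suc.prems(3) par show ?thesis by auto
    qed
  next
    case i: False
    show ?thesis
    proof (cases "j < 2 ^ r")
      case True
      with i Suc.prems(3) par show ?thesis by auto
    next
      case False
      with i have "bitrev r (i - 2 ^ r) = bitrev r (j - 2 ^ r)" using Suc.prems(3) by auto
      moreover have "i - 2 ^ r < 2 ^ r" "j - 2 ^ r < 2 ^ r" using i False Suc.prems by auto
      ultimately have "i - 2 ^ r = j - 2 ^ r" using Suc.IH by blast
      then show ?thesis using i False by auto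
    qed
  qed
qed simp

lemma bij_betw_bitrev: "bij_betw (bitrev r) {..<2 ^ r} {..<2 ^ r}"
proof -
  have "inj_on (bitrev r) {..<2 ^ r}" by (auto simp: inj_on_def intro: bitrev_inj)
  moreover have "bitrev r ` {..<2 ^ r} \<subseteq> {..<2 ^ r}" by (auto intro: bitrev_less)
  ultimately show ?thesis
    by (metis bij_betw_def endo_inj_surj finite_lessThan)
qed

lemma sum_bitrev: "(\<Sum>i<2 ^ r. F (bitrev r i)) = (\<Sum>c<2 ^ r. F c)"
  using sum.reindex_bij_betw[OF bij_betw_bitrev] .

text \<open>
The first \<open>2 ^ s\<close> values are exactly the multiples of \<open>2 ^ (r - s)\<close>; this is what keeps them apart from
each other.
\<close>

lemma bitrev_dvd: "i < 2 ^ s \<Longrightarrow> s \<le> r \<Longrightarrow> 2 ^ (r - s) dvd bitrev r i"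
proof (induction r)
  case (Suc r)
  show ?case
  proof (cases "s = Suc r")
    case False
    with Suc have s: "s \<le> r" "2 ^ (r - s) dvd bitrev r i" by auto
    have "i < 2 ^ r" using Suc.prems s by (meson less_le_trans one_le_numeral power_increasing)
    moreover have "(2::nat) ^ (Suc r - s) = 2 * 2 ^ (r - s)" using s by (simp add: Suc_diff_le)
    ultimately show ?thesis using s by simp
  qed simp
qed simp

lemma sum_of_bool_less: "(\<Sum>i<n. of_bool (i < b)) = real (min n b)"
proof -
  have "(\<Sum>i<n. of_bool (i < b)) = real (card {i \<in> {..<n}. i < b})"
    by (simp add: Int_def)
  also have "{i \<in> {..<n}. i < b} = {..<min n b}" by auto
  finally show ?thesis by simp
qed

lemma bitrev_count_full: "b \<le> 2 ^ r \<Longrightarrow> (\<Sum>i<2 ^ r. of_bool (bitrev r i < b)) = real b"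
  by (simp add: sum_bitrev[of "\<lambda>c. of_bool (c < b)"] sum_of_bool_less min_absorb2)

lemma sum_lessThan_add:
  fixes f :: "nat \<Rightarrow> real"
  shows "(\<Sum>n<M + K. f n) = (\<Sum>n<M. f n) + (\<Sum>n<K. f (M + n))"
  by (induction K) auto

text \<open>
An initial segment of length at least \<open>2 ^ r\<close> of the \<open>r + 1\<close> digit reversal starts with all even
values, which are counted without error, and goes on with odd values, which follow the \<open>r\<close> digit reversal.
Each digit thus costs only the rounding error made when \<open>b\<close> is halved, as \<open>u\<close> for even and \<open>d\<close> for
odd values.
\<close>

lemma bitrev_discrepancy:
  "j \<le> 2 ^ r \<Longrightarrow> b \<le> 2 ^ r \<Longrightarrow>
    \<bar>(\<Sum>i<j. of_bool (bitrev r i < b)) - real j * real b / 2 ^ r\<bar> \<le> real r"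
proof (induction r arbitrary: j b)
  case 0
  then have "(j = 0 \<or> j = 1) \<and> (b = 0 \<or> b = 1)" by auto
  then show ?case by (auto simp: lessThan_Suc)
next
  case (Suc r)
  define u d where "u = (b + 1) div 2" and "d = b div 2"
  have bb: "u + d = b" "d \<le> u" "u \<le> d + 1" "u \<le> 2 ^ r" "d \<le> 2 ^ r" 
    using Suc.prems unfolding u_def d_def power_Suc by presburger+
  have lu: "2 * x < b \<longleftrightarrow> x < u" and ld: "2 * x + 1 < b \<longleftrightarrow> x < d" for x
    unfolding u_def d_def by presburger+
  have rb: "real b = real u + real d" using bb(1) by (metis of_nat_add)
  show ?case
  proof (cases "j \<le> 2 ^ r")
    case True
    have "(\<Sum>i<j. of_bool (bitrev (Suc r) i < b)) = (\<Sum>i<j. of_bool (bitrev r i < u) :: real)"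
      using True by (intro sum.cong) (auto simp: lu)
    moreover have "\<bar>(\<Sum>i<j. of_bool (bitrev r i < u)) - real j * real u / 2 ^ r\<bar> \<le> real r"
      using Suc.IH True bb by blast
    moreover have "real j * real u / 2 ^ r - real j * real b / 2 ^ Suc r
        = (real j / 2 ^ r) * ((real u - real d) / 2)"
      unfolding rb by (simp add: field_simps)
    moreover have "0 \<le> (real j / 2 ^ r) * ((real u - real d) / 2)" 
      using bb by (intro mult_nonneg_nonneg) auto
    moreover have "(real j / 2 ^ r) * ((real u - real d) / 2) \<le> 1 * 1"
      using bb True by (intro mult_mono) (auto simp: numeral_power_le_of_nat_cancel_iff of_nat_le_numeral_power_cancel_iff)
    ultimately show ?thesis by linarith
  next
    case False
    define k where "k = j - 2 ^ r"
    have k: "j = 2 ^ r + k" "k \<le> 2 ^ r" using False Suc.prems unfolding k_def by auto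
    have "(\<Sum>i<j. of_bool (bitrev (Suc r) i < b)) =
        (\<Sum>i<2 ^ r. of_bool (bitrev (Suc r) i < b)) + (\<Sum>i<k. of_bool (bitrev (Suc r) (2 ^ r + i) < b) :: real)"
      unfolding k(1) by (rule sum_lessThan_add)
    also have "(\<Sum>i<2 ^ r. of_bool (bitrev (Suc r) i < b)) = (\<Sum>i<2 ^ r. of_bool (bitrev r i < u) :: real)"
      by (intro sum.cong) (auto simp: lu)
    also have "\<dots> = real u" using bb by (intro bitrev_count_full)
    also have "(\<Sum>i<k. of_bool (bitrev (Suc r) (2 ^ r + i) < b) :: real) = (\<Sum>i<k. of_bool (bitrev r i < d))"
      using ld by (intro sum.cong) auto
    finally have "(\<Sum>i<j. of_bool (bitrev (Suc r) i < b)) = real u + (\<Sum>i<k. of_bool (bitrev r i < d))" .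
    moreover have "\<bar>(\<Sum>i<k. of_bool (bitrev r i < d)) - real k * real d / 2 ^ r\<bar> \<le> real r"
      using Suc.IH k bb by blast
    moreover have "real u + real k * real d / 2 ^ r - real j * real b / 2 ^ Suc r
        = (1 - real k / 2 ^ r) * ((real u - real d) / 2)"
      unfolding rb k by (simp add: field_simps)
    moreover have "0 \<le> (1 - real k / 2 ^ r) * ((real u - real d) / 2)" 
      using bb k by (intro mult_nonneg_nonneg) (auto simp: of_nat_le_numeral_power_cancel_iff)
    moreover have "(1 - real k / 2 ^ r) * ((real u - real d) / 2) \<le> 1 * 1"
      using bb k by (intro mult_mono) (auto simp: of_nat_le_numeral_power_cancel_iff)
    ultimately show ?thesis by linarith
  qed
qed

text \<open>
Used to pass from an arbitrary time \<open>t\<close> to a full initial segment of the bit reversal at the price of a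
factor \<open>2\<close>.
\<close>

lemma power2_between:
  assumes "t \<ge> (1::nat)"
  shows "\<exists>s. t \<le> 2 ^ s \<and> 2 ^ s < 2 * t"
  using assms
proof (induction t rule: nat_induct_at_least)
  case base
  show ?case by (intro exI[of _ 0]) simp
next
  case (Suc t)
  then obtain s where s: "t \<le> 2 ^ s" "2 ^ s < 2 * t" by blast
  show ?case
  proof (cases "t = 2 ^ s")
    case True
    with Suc.hyps show ?thesis by (intro exI[of _ "Suc s"]) auto
  next
    case False
    with s show ?thesis by (intro exI[of _ s]) auto
  qed
qed

section \<open>Closeness on a cyclic grid\<close>

text \<open>
Cyclic distance at most \<open>g\<close> on the integers modulo \<open>H\<close>.
\<close>

definition near :: "nat \<Rightarrow> nat \<Rightarrow> nat \<Rightarrow> nat \<Rightarrow> bool" where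
  "near H g X Y \<longleftrightarrow> (int X - int Y) mod int H \<le> int g \<or> (int Y - int X) mod int H \<le> int g"

lemma near_commute: "near H g X Y \<longleftrightarrow> near H g Y X"
  by (auto simp: near_def)

lemma near_iff_ex: 
  assumes "H > 0"
  shows "near H g X Y \<longleftrightarrow> (\<exists>n::int. \<bar>int X - int Y - n * int H\<bar> \<le> int g)"
proof
  assume "near H g X Y"
  then consider "(int X - int Y) mod int H \<le> int g" | "(int Y - int X) mod int H \<le> int g"
    by (auto simp: near_def)
  then show "\<exists>n. \<bar>int X - int Y - n * int H\<bar> \<le> int g"
  proof cases
    case 1
    then show ?thesis using assms
      by (intro exI[of _ "(int X - int Y) div int H"]) (simp add: minus_div_mult_eq_mod)
  next
    case 2
    have "int X - int Y - (- ((int Y - int X) div int H)) * int H = - ((int Y - int X) mod int H)"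
      by (simp add: minus_div_mult_eq_mod[symmetric])
    then show ?thesis using 2 assms
      by (intro exI[of _ "- ((int Y - int X) div int H)"]) simp
  qed
next
  assume "\<exists>n. \<bar>int X - int Y - n * int H\<bar> \<le> int g"
  then obtain n where n: "\<bar>int X - int Y - n * int H\<bar> \<le> int g" by blast
  have le: "a mod int H \<le> a" if "a \<ge> 0" for a using that by (rule zmod_le_nonneg_dividend)
  show "near H g X Y"
  proof (cases "int X - int Y - n * int H \<ge> 0")
    case True
    have "(int X - int Y) mod int H = (int X - int Y - n * int H) mod int H"
      by (metis mod_mult_self4 diff_add_cancel mult.commute add.commute)
    also have "\<dots> \<le> int g" using le[OF True] n by simp
    finally show ?thesis by (simp add: near_def)
  next
    case False
    have eq: "int Y - int X = (int Y - int X + n * int H) + (- n) * int H" by (simp add: algebra_simps)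
    have "(int Y - int X) mod int H = (int Y - int X + n * int H) mod int H"
      by (subst eq) (rule mod_mult_self1)
    also have "\<dots> \<le> int g" using le[of "int Y - int X + n * int H"] n False by simp
    finally show ?thesis by (simp add: near_def)
  qed
qed

lemma dist_nearest_int_le_iff: "dist_nearest_int t \<le> \<delta> \<longleftrightarrow> (\<exists>n::int. \<bar>t - of_int n\<bar> \<le> \<delta>)"
proof
  assume a: "dist_nearest_int t \<le> \<delta>"
  obtain x where "x \<in> \<int>" "infdist t \<int> = dist t x"
    using infdist_attains_inf[of "\<int> :: real set" t] closed_Ints by (metis Ints_0 empty_iff)
  then show "\<exists>n::int. \<bar>t - of_int n\<bar> \<le> \<delta>"
    using a by (auto simp: dist_nearest_int_def dist_real_def elim!: Ints_cases)
next
  assume "\<exists>n::int. \<bar>t - of_int n\<bar> \<le> \<delta>"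
  then obtain n :: int where "dist t (of_int n) \<le> \<delta>" by (auto simp: dist_real_def)
  then show "dist_nearest_int t \<le> \<delta>"
    unfolding dist_nearest_int_def by (meson infdist_le Ints_of_int order_trans)
qed

text \<open>
On the grid of multiples of \<open>1 / H\<close> only the integer part of \<open>\<delta> H\<close> matters, so that finitely many
distances have to be controlled.
\<close>

lemma dist_nearest_int_grid:
  assumes "H > 0" "\<delta> \<ge> 0"
  shows "dist_nearest_int (real X / real H - real Y / real H) \<le> \<delta> \<longleftrightarrow> near H (nat \<lfloor>\<delta> * real H\<rfloor>) X Y"
proof -
  have "\<bar>real X / real H - real Y / real H - of_int n\<bar> \<le> \<delta> \<longleftrightarrow>
      \<bar>int X - int Y - n * int H\<bar> \<le> int (nat \<lfloor>\<delta> * real H\<rfloor>)" for n :: int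
  proof -
    have "\<bar>real X / real H - real Y / real H - of_int n\<bar> = \<bar>(real X - real Y - of_int n * real H) / real H\<bar>"
      using assms by (simp add: field_simps)
    also have "\<dots> = \<bar>real X - real Y - of_int n * real H\<bar> / real H" by simp
    also have "\<dots> = of_int \<bar>int X - int Y - n * int H\<bar> / real H" by simp
    also have "\<dots> \<le> \<delta> \<longleftrightarrow> of_int \<bar>int X - int Y - n * int H\<bar> \<le> \<delta> * real H"
      using assms by (simp add: field_simps)
    also have "\<dots> \<longleftrightarrow> \<bar>int X - int Y - n * int H\<bar> \<le> \<lfloor>\<delta> * real H\<rfloor>"
      by (simp add: le_floor_iff)
    finally show ?thesis using assms by simp
  qed
  then show ?thesis using assms by (simp add: dist_nearest_int_le_iff near_iff_ex)
qed

text \<open>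
The neighbours of \<open>Y\<close> are the residues of \<open>Y - g, \<dots>, Y + g\<close>, which are distinct because
\<open>2 g + 1 \<le> H\<close>.
\<close>

lemma near_count:
  assumes "2 * g + 1 \<le> H"
  shows "(\<Sum>X<H. of_bool (near H g X Y)) = real (2 * g + 1)"
proof -
  have H: "H > 0" using assms by simp
  \<comment> \<open>integer displacements \<open>k\<close> parametrize the neighbours of \<open>Y\<close>\<close>
  define F where "F k = nat ((int Y + k) mod int H)" for k
  have IF: "int (F k) = (int Y + k) mod int H" for k using H by (simp add: F_def)
  have "bij_betw F {- int g..int g} {X \<in> {..<H}. near H g X Y}"
    unfolding bij_betw_def
  proof
    show "inj_on F {- int g..int g}"
    proof (rule inj_onI)
      fix k l assume kl: "k \<in> {- int g..int g}" "l \<in> {- int g..int g}" "F k = F l"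
      then have "(int Y + k) mod int H = (int Y + l) mod int H" using IF by metis
      then have "int H dvd (int Y + k) - (int Y + l)" by (simp add: mod_eq_dvd_iff)
      then have "int H dvd k - l" by simp
      moreover have "\<bar>k - l\<bar> < int H" using kl assms by auto
      ultimately show "k = l" using zdvd_not_zless[of "\<bar>k - l\<bar>" "int H"] by force
    qed
    show "F ` {- int g..int g} = {X \<in> {..<H}. near H g X Y}"
    proof (intro equalityI subsetI)
      fix X assume "X \<in> F ` {- int g..int g}"
      then obtain k where k: "k \<in> {- int g..int g}" "X = F k" by blast
      have "int X < int H" unfolding k(2) IF using H by simp
      moreover have "int X - int Y - (- ((int Y + k) div int H)) * int H = k"
        unfolding k(2) IF by (simp add: minus_div_mult_eq_mod[symmetric])
      then have "near H g X Y" using k H unfolding near_iff_ex[OF H] 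
        by (intro exI[of _ "- ((int Y + k) div int H)"]) auto
      ultimately show "X \<in> {X \<in> {..<H}. near H g X Y}" by simp
    next
      fix X assume X: "X \<in> {X \<in> {..<H}. near H g X Y}"
      then obtain n where n: "\<bar>int X - int Y - n * int H\<bar> \<le> int g" using near_iff_ex[OF H] by auto
      have "int (F (int X - int Y - n * int H)) = (int X + (- n) * int H) mod int H"
        unfolding IF by (simp add: algebra_simps)
      also have "\<dots> = int X mod int H" by (rule mod_mult_self1)
      also have "\<dots> = int X" using X by simp
      finally show "X \<in> F ` {- int g..int g}" using n by (intro image_eqI[of _ _ "int X - int Y - n * int H"]) auto
    qed
  qed
  then have "card {X \<in> {..<H}. near H g X Y} = card {- int g..int g}" by (metis bij_betw_same_card)
  then have "card {X \<in> {..<H}. near H g X Y} = 2 * g + 1" by simp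
  then show ?thesis by (simp add: Int_def)
qed

definition adjacent :: "nat \<Rightarrow> nat \<Rightarrow> nat \<Rightarrow> bool" where
  "adjacent m c d \<longleftrightarrow> d = c \<or> d = (c + 1) mod m \<or> c = (d + 1) mod m"

lemma near_adjacent:
  assumes "g \<le> W" "0 < W" "X < m * W" "Y < m * W" "near (m * W) g X Y"
  shows "adjacent m (X div W) (Y div W)"
proof -
  have *: "Y div W = X div W \<or> Y div W = (X div W + 1) mod m"
    if "X < m * W" "Y < m * W" "(int Y - int X) mod int (m * W) \<le> int g" for X Y
  proof -
    define d where "d = nat ((int Y - int X) mod int (m * W))"
    have m: "m > 0" using that by (cases m) auto
    have id: "int d = (int Y - int X) mod int (m * W)" using m assms(2) by (simp add: d_def)
    then have dg: "d \<le> W" using that(3) assms(1) by linarith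
    have Xm: "X mod W < W" using assms(2) by simp
    have c: "X div W < m" using that(1) by (simp add: less_mult_imp_div_less)
    have "int ((X + d) mod (m * W)) = (int X + (int Y - int X)) mod int (m * W)"
      unfolding zmod_int of_nat_add id by (simp add: mod_add_right_eq)
    then have "int ((X + d) mod (m * W)) = int (Y mod (m * W))" by (simp add: zmod_int)
    then have Y: "Y = (X + d) mod (m * W)" using that(2) by simp
    have q: "(X + d) div W = X div W + (X mod W + d) div W"
    proof -
      have "X + d = (X mod W + d) + X div W * W" by simp
      then show ?thesis using assms(2) by (metis add.commute div_mult_self1 less_numeral_extra(3))
    qed
    have "X mod W + d < 2 * W" using Xm dg by simp
    then have "(X mod W + d) div W < 2" by (simp add: less_mult_imp_div_less)
    then have q2: "(X + d) div W = X div W \<or> (X + d) div W = X div W + 1" using q by auto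
    have "Y div W = ((X + d) div W) mod m"
    proof -
      have "(X + d) mod (W * m) = W * ((X + d) div W mod m) + (X + d) mod W" by (rule mod_mult2_eq)
      then show ?thesis using assms(2) unfolding Y by (simp add: mult.commute)
    qed
    then show ?thesis using q2 c by auto
  qed
  from assms(5) consider "(int Y - int X) mod int (m * W) \<le> int g" | "(int X - int Y) mod int (m * W) \<le> int g"
    unfolding near_def by auto
  then show ?thesis
  proof cases
    case 1
    from *[OF assms(3,4) 1] show ?thesis by (auto simp: adjacent_def)
  next
    case 2
    from *[OF assms(4,3) 2] show ?thesis by (auto simp: adjacent_def)
  qed
qed

lemma card_adjacent:
  "card {d. d < m \<and> adjacent m c d} \<le> 3"
proof -
  have inj: "a = b" if "a < m" "b < m" "c = (a + 1) mod m" "c = (b + 1) mod m" for a b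
  proof -
    have "Suc a mod m = Suc b mod m" using that by simp
    then show ?thesis using that by (auto simp: mod_Suc split: if_splits)
  qed
  have "\<exists>e. {d. d < m \<and> adjacent m c d} \<subseteq> {c, (c + 1) mod m, e}"
  proof (cases "\<exists>e<m. c = (e + 1) mod m")
    case True
    then obtain e where "e < m" "c = (e + 1) mod m" by blast
    then have "{d. d < m \<and> adjacent m c d} \<subseteq> {c, (c + 1) mod m, e}"
      unfolding adjacent_def using inj[of _ e] by blast
    then show ?thesis ..
  next
    case False
    then have "{d. d < m \<and> adjacent m c d} \<subseteq> {c, (c + 1) mod m, c}"
      unfolding adjacent_def by blast
    then show ?thesis ..
  qed
  then obtain e where e: "{d. d < m \<and> adjacent m c d} \<subseteq> {c, (c + 1) mod m, e}" by blast
  have "card {c, (c + 1) mod m, e} \<le> 3" by (simp add: card_insert_if)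
  then show ?thesis using card_mono[OF _ e] by simp
qed

section \<open>Counting points of a lattice\<close>

lemma sum_lessThan_mult:
  fixes f :: "nat \<Rightarrow> real"
  shows "(\<Sum>n<a * b. f n) = (\<Sum>i<a. \<Sum>j<b. f (i * b + j))"
  by (induction a) (simp_all add: sum_lessThan_add[of f] add.commute[of b])

text \<open>
A translation permutes the residues modulo \<open>W\<close>.
\<close>

lemma sum_shift_mod:
  fixes F :: "nat \<Rightarrow> real"
  shows "(\<Sum>u<W. F ((s + u) mod W)) = (\<Sum>u<W. F u)"
proof (cases "W = 0")
  case False
  have "inj_on (\<lambda>u. (s + u) mod W) {..<W}"
  proof (rule inj_onI)
    fix x y assume xy: "x \<in> {..<W}" "y \<in> {..<W}" "(s + x) mod W = (s + y) mod W"
    then have "int W dvd int (s + x) - int (s + y)" by (metis mod_eq_dvd_iff zmod_int)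
    then have "int W dvd int x - int y" by simp
    then have "x mod W = y mod W" by (metis mod_eq_dvd_iff zmod_int nat_int)
    then show "x = y" using xy by simp
  qed
  moreover have "(\<lambda>u. (s + u) mod W) ` {..<W} \<subseteq> {..<W}" using False by auto
  ultimately have "bij_betw (\<lambda>u. (s + u) mod W) {..<W} {..<W}"
    by (metis bij_betw_def endo_inj_surj finite_lessThan)
  then show ?thesis by (rule sum.reindex_bij_betw)
qed simp

text \<open>
Modulo \<open>K V\<close> the shifted lattice is \<open>u0, u0 + V, u0 + 2 V, \<dots>\<close> with \<open>u0 < V\<close>, and counting an
arithmetic progression below \<open>b\<close> errs by at most one.
\<close>

lemma lattice_count:
  fixes b K V u :: nat
  assumes "V > 0" "b \<le> K * V"
  shows "\<bar>(\<Sum>k<K. of_bool ((k * V + u) mod (K * V) < b)) - real b / real V\<bar> \<le> 1"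
proof -
  define u0 u1 where "u0 = u mod V" and "u1 = u div V"
  have u0: "u0 < V" using assms by (simp add: u0_def)
  have "(k * V + u) mod (K * V) = ((u1 + k) mod K) * V + u0" for k
  proof -
    have "k * V + u = V * (u1 + k) + u0" by (simp add: u0_def u1_def algebra_simps)
    moreover have "(V * (u1 + k) + u0) mod (V * K) = V * ((V * (u1 + k) + u0) div V mod K) + (V * (u1 + k) + u0) mod V"
      by (rule mod_mult2_eq)
    ultimately show ?thesis using u0 by (simp add: mult.commute)
  qed
  then have "(\<Sum>k<K. of_bool ((k * V + u) mod (K * V) < b)) = (\<Sum>k<K. of_bool (((u1 + k) mod K) * V + u0 < b) :: real)"
    by simp
  also have "\<dots> = (\<Sum>k<K. of_bool (k * V + u0 < b))"
    by (rule sum_shift_mod)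
  \<comment> \<open>the number of \<open>k\<close> with \<open>k V + u0 < b\<close>, that is \<open>b - u0\<close> divided by \<open>V\<close> and rounded up\<close>
  also define q where "q = (b + (V - 1 - u0)) div V"
  have "k * V + u0 < b \<longleftrightarrow> k < q" for k
  proof -
    have "k < q \<longleftrightarrow> Suc k \<le> q" by auto
    also have "\<dots> \<longleftrightarrow> Suc k * V \<le> b + (V - 1 - u0)"
      unfolding q_def using assms(1) by (simp add: less_eq_div_iff_mult_less_eq)
    also have "\<dots> \<longleftrightarrow> k * V + u0 < b" using u0 by auto
    finally show ?thesis by simp
  qed
  then have "(\<Sum>k<K. of_bool (k * V + u0 < b)) = real (min K q)"
    using sum_of_bool_less[of q K] by simp
  finally have eq: "(\<Sum>k<K. of_bool ((k * V + u) mod (K * V) < b)) = real (min K q)" .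
  have "q * V \<le> b + (V - 1 - u0)" unfolding q_def by simp
  then have "real (q * V) \<le> real (b + V)" by (intro of_nat_mono) linarith
  then have 1: "real q \<le> real b / real V + 1" using assms(1) by (simp add: field_simps)
  have "b + (V - 1 - u0) < (q + 1) * V" unfolding q_def using assms(1)
    by (metis Suc_eq_plus1 dividend_less_div_times mult_Suc)
  then have "real b < real ((q + 1) * V)" by (intro of_nat_less_iff[THEN iffD2]) linarith
  then have 2: "real b / real V \<le> real q + 1" using assms(1) by (simp add: field_simps)
  have "real b \<le> real K * real V" using assms(2) by (metis of_nat_le_iff of_nat_mult)
  then have 3: "real b / real V \<le> real K" using assms(1) by (simp add: field_simps)
  show ?thesis unfolding eq using 1 2 3 by (auto simp: min_def abs_le_iff)
qed

section \<open>The points of a block and their discrepancy\<close>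

text \<open>
The parameters of one block.  There are \<open>m\<close> cells of \<open>W\<close> grid points each, and \<open>K\<close> lattice positions of
spacing \<open>V\<close> in a cell; \<open>L\<close> is the number of random shifts of a cell.
\<close>

locale block =
  fixes \<mu> r \<nu> L m K V W H :: nat
  assumes m_def: "m = 2 ^ \<mu>" and K_def: "K = 2 ^ r" and V_def: "V = 2 ^ \<nu>"
    and W_def: "W = K * V" and H_def: "H = m * W" and L_pos: "L > 0"
begin

lemma pos_params: "m > 0" "K > 0" "V > 0" "W > 0" "H > 0"
  using m_def K_def V_def W_def H_def by auto

text \<open>
The grid position in cell \<open>c\<close> for the \<open>i\<close>-th van der Corput position and the shift \<open>u\<close>.
\<close>

definition loc :: "nat \<Rightarrow> nat \<Rightarrow> nat \<Rightarrow> nat" where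
  "loc i c u = c * W + (bitrev r i * V + u) mod W"

text \<open>
The points in their order of appearance: \<open>n div m\<close> is the number of the pass, whose quotient and remainder by
\<open>L\<close> are \<open>i\<close> and \<open>l\<close>, and \<open>n mod m\<close> is the time inside the pass.
\<close>

definition newpt :: "(nat \<times> nat \<Rightarrow> nat) \<Rightarrow> nat \<Rightarrow> nat" where
  "newpt w n = loc (n div m div L) (bitrev \<mu> (n mod m)) (w (bitrev \<mu> (n mod m), n div m mod L))"

lemma loc_div: "loc i c u div W = c"
  using pos_params by (simp add: loc_def)

lemma loc_less:
  assumes "c < m"
  shows "loc i c u < H"
proof -
  have "(bitrev r i * V + u) mod W < W" using pos_params by simp
  moreover have "Suc c * W \<le> m * W" using assms by (intro mult_le_mono1) auto
  moreover have "Suc c * W = W + c * W" by simp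
  ultimately show ?thesis unfolding loc_def H_def by linarith
qed

lemma newpt_less: "newpt w n < H"
  unfolding newpt_def using pos_params bitrev_less[of "n mod m" \<mu>]
  by (intro loc_less) (simp add: m_def)

lemma sum_newpt_passes:
  fixes F :: "nat \<Rightarrow> real"
  shows "(\<Sum>n<P * m. F (newpt w n)) = (\<Sum>p<P. \<Sum>c<m. F (loc (p div L) c (w (c, p mod L))))"
proof -
  have "(\<Sum>j<m. F (newpt w (p * m + j))) = (\<Sum>c<m. F (loc (p div L) c (w (c, p mod L))))" for p
  proof -
    have "(\<Sum>j<m. F (newpt w (p * m + j))) = (\<Sum>j<m. F (loc (p div L) (bitrev \<mu> j) (w (bitrev \<mu> j, p mod L))))"
      using pos_params by (intro sum.cong) (auto simp: newpt_def)
    also have "\<dots> = (\<Sum>c<m. F (loc (p div L) c (w (c, p mod L))))"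
      unfolding m_def by (rule sum_bitrev)
    finally show ?thesis .
  qed
  then show ?thesis by (simp add: sum_lessThan_mult)
qed

lemma sum_newpt_chunks:
  fixes F :: "nat \<Rightarrow> real"
  shows "(\<Sum>n<t * L * m. F (newpt w n)) = (\<Sum>i<t. \<Sum>l<L. \<Sum>c<m. F (loc i c (w (c, l))))"
  unfolding sum_newpt_passes sum_lessThan_mult[of _ t L] using L_pos by (intro sum.cong) auto

lemma loc_less_iff: "loc i c u < \<beta> \<longleftrightarrow> c < \<beta> div W \<or> c = \<beta> div W \<and> (bitrev r i * V + u) mod W < \<beta> mod W"
proof -
  let ?y = "(bitrev r i * V + u) mod W"
  have y: "?y < W" and b: "\<beta> mod W < W" using pos_params by auto
  have \<beta>: "\<beta> = \<beta> div W * W + \<beta> mod W" by simp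
  consider "c < \<beta> div W" | "c = \<beta> div W" | "c > \<beta> div W" by linarith
  then show ?thesis
  proof cases
    case 1
    then have "Suc c * W \<le> \<beta> div W * W" by (intro mult_le_mono1) auto
    moreover have "Suc c * W = W + c * W" by simp
    ultimately have "loc i c u < \<beta>" unfolding loc_def using y \<beta> by linarith
    with 1 show ?thesis by simp
  next
    case 2
    then show ?thesis unfolding loc_def using \<beta> by (metis add_less_cancel_left less_irrefl)
  next
    case 3
    then have "Suc (\<beta> div W) * W \<le> c * W" by (intro mult_le_mono1) auto
    moreover have "Suc (\<beta> div W) * W = W + \<beta> div W * W" by simp
    ultimately have "\<not> loc i c u < \<beta>" unfolding loc_def using b \<beta> by linarith
    with 3 show ?thesis by simp
  qed
qed

text \<open>
The deviation of one pass for the test interval \<open>[0, \<beta>)\<close>.  It comes from the cell \<open>\<beta> div W\<close> alone;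
the condition \<open>\<beta> div W < m\<close> excludes \<open>\<beta> = H\<close>, where there is no such cell.
\<close>

definition pass_error :: "(nat \<times> nat \<Rightarrow> nat) \<Rightarrow> nat \<Rightarrow> nat \<Rightarrow> nat \<Rightarrow> real" where
  "pass_error w \<beta> i l =
     of_bool (\<beta> div W < m \<and> (bitrev r i * V + w (\<beta> div W, l)) mod W < \<beta> mod W) - real (\<beta> mod W) / real W"

lemma pass_error_le: "\<bar>pass_error w \<beta> i l\<bar> \<le> 1"
proof -
  have "\<beta> mod W \<le> W" using pos_params by (simp add: less_imp_le)
  then have "real (\<beta> mod W) / real W \<le> 1" "0 \<le> real (\<beta> mod W) / real W" using pos_params by auto
  moreover have "(0::real) \<le> of_bool P" "(of_bool P :: real) \<le> 1" for P by auto
  ultimately show ?thesis unfolding pass_error_def abs_le_iff by (smt (verit))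
qed

lemma real_div_mod: "real \<beta> / real W = real (\<beta> div W) + real (\<beta> mod W) / real W"
proof -
  have "real \<beta> = real (\<beta> div W) * real W + real (\<beta> mod W)"
    by (metis div_mult_mod_eq of_nat_add of_nat_mult)
  then show ?thesis using pos_params by (simp add: field_simps)
qed

lemma pass_count:
  assumes "\<beta> \<le> H"
  shows "(\<Sum>c<m. of_bool (loc i c (w (c, l)) < \<beta>)) = real \<beta> / real W + pass_error w \<beta> i l"
proof -
  let ?c = "\<beta> div W"
  have c: "?c \<le> m" using assms pos_params unfolding H_def 
    by (metis div_le_mono div_mult_self_is_m)
  have "(\<Sum>c<m. of_bool (loc i c (w (c, l)) < \<beta>)) =
    (\<Sum>c<m. of_bool (c < ?c) + (if c = ?c then of_bool ((bitrev r i * V + w (?c, l)) mod W < \<beta> mod W) else 0))"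
    by (intro sum.cong) (auto simp: loc_less_iff)
  also have "\<dots> = real ?c + of_bool (?c < m \<and> (bitrev r i * V + w (?c, l)) mod W < \<beta> mod W)"
    unfolding sum.distrib sum_of_bool_less using c by simp
  finally show ?thesis unfolding real_div_mod[of \<beta>] pass_error_def by simp
qed

lemma passes_count:
  assumes "\<beta> \<le> H"
  shows "(\<Sum>n<P * m. of_bool (newpt w n < \<beta>)) - real (P * m) * real \<beta> / real H
     = (\<Sum>p<P. pass_error w \<beta> (p div L) (p mod L))"
proof -
  have "real (P * m) * real \<beta> / real H = real P * (real \<beta> / real W)"
    unfolding H_def using pos_params by simp
  then show ?thesis
    unfolding sum_newpt_passes[of "\<lambda>x. of_bool (x < \<beta>)"] pass_count[OF assms] by (simp add: sum.distrib)
qed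

text \<open>
Every complete pass contributes at most \<open>1\<close>, and the unfinished pass contributes the discrepancy of bit
reversal and at most one point of the cell that contains \<open>\<beta>\<close>.
\<close>

lemma prefix_discrepancy:
  assumes "\<beta> \<le> H" "n \<le> K * L * m"
  shows "\<bar>(\<Sum>k<n. of_bool (newpt w k < \<beta>)) - real n * real \<beta> / real H\<bar> \<le> real (K * L) + real \<mu> + 1"
proof -
  define P j where "P = n div m" and "j = n mod m"
  have n: "n = P * m + j" by (simp add: P_def j_def)
  have j: "j < m" using pos_params by (simp add: j_def)
  have P: "P \<le> K * L" unfolding P_def using assms(2) pos_params by (metis div_le_mono div_mult_self_is_m)
  let ?c = "\<beta> div W"
  have c: "?c \<le> m" using assms pos_params unfolding H_def 
    by (metis div_le_mono div_mult_self_is_m)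
  define part where "part = (\<Sum>k<j. of_bool (newpt w (P * m + k) < \<beta>) :: real)"
  define B where "B = (\<Sum>k<j. of_bool (bitrev \<mu> k = ?c \<and> newpt w (P * m + k) < \<beta>) :: real)"
  have inj: "k = k'" if "k < j" "k' < j" "bitrev \<mu> k = bitrev \<mu> k'" for k k'
    using that j bitrev_inj[of k \<mu> k'] by (simp add: m_def)
  have "card ({..<j} \<inter> {k. bitrev \<mu> k = ?c \<and> newpt w (P * m + k) < \<beta>}) \<le> 1"
    unfolding card_le_Suc0_iff_eq[OF finite_Int[OF disjI1[OF finite_lessThan]], folded One_nat_def]
    using inj by fastforce
  then have B: "0 \<le> B" "B \<le> 1" by (auto simp: B_def)
  have "part = (\<Sum>k<j. of_bool (bitrev \<mu> k < ?c) + of_bool (bitrev \<mu> k = ?c \<and> newpt w (P * m + k) < \<beta>))"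
    unfolding part_def using j by (intro sum.cong) (auto simp: newpt_def loc_less_iff)
  then have part: "part = (\<Sum>k<j. of_bool (bitrev \<mu> k < ?c)) + B"
    by (simp only: sum.distrib B_def)
  have br: "\<bar>(\<Sum>k<j. of_bool (bitrev \<mu> k < ?c)) - real j * real ?c / real m\<bar> \<le> real \<mu>"
    using bitrev_discrepancy[of j \<mu> ?c] j c by (simp add: m_def)
  \<comment> \<open>the share of the expected number of points that belongs to the cell of \<open>\<beta>\<close>\<close>
  define \<rho> where "\<rho> = (real j / real m) * (real (\<beta> mod W) / real W)"
  have "\<beta> mod W \<le> W" using pos_params by (simp add: less_imp_le)
  then have "\<rho> \<le> 1 * 1" "0 \<le> \<rho>" unfolding \<rho>_def using j pos_params by (auto intro!: mult_mono)
  then have \<rho>: "0 \<le> \<rho>" "\<rho> \<le> 1" by auto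
  have "real j * real \<beta> / real H = (real j / real m) * (real \<beta> / real W)"
    unfolding H_def by simp
  also have "\<dots> = real j * real ?c / real m + \<rho>"
    unfolding real_div_mod[of \<beta>] \<rho>_def by (simp add: algebra_simps)
  finally have "\<bar>part - real j * real \<beta> / real H\<bar> \<le> real \<mu> + 1"
    using br B \<rho> unfolding part by linarith
  moreover have "\<bar>\<Sum>p<P. pass_error w \<beta> (p div L) (p mod L)\<bar> \<le> real (K * L)"
  proof -
    have "\<bar>\<Sum>p<P. pass_error w \<beta> (p div L) (p mod L)\<bar> \<le> (\<Sum>p<P. \<bar>pass_error w \<beta> (p div L) (p mod L)\<bar>)"
      by (rule sum_abs)
    also have "\<dots> \<le> real (card {..<P}) * 1" by (intro sum_bounded_above pass_error_le)
    also have "\<dots> \<le> real (K * L)" using P by (simp del: of_nat_mult)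
    finally show ?thesis .
  qed
  moreover have "(\<Sum>k<n. of_bool (newpt w k < \<beta>)) = (\<Sum>k<P * m. of_bool (newpt w k < \<beta>)) + part"
    unfolding n part_def by (rule sum_lessThan_add)
  moreover have "real n * real \<beta> / real H = real (P * m) * real \<beta> / real H + real j * real \<beta> / real H"
    unfolding n by (simp add: algebra_simps add_divide_distrib)
  ultimately show ?thesis using passes_count[OF assms(1), of w P] by linarith
qed

text \<open>
In a complete block the errors of the passes with the same \<open>l\<close> do not add up, since their points in the
decisive cell form a complete shifted lattice.
\<close>

lemma complete_discrepancy:
  assumes "\<beta> \<le> H"
  shows "\<bar>(\<Sum>k<K * L * m. of_bool (newpt w k < \<beta>)) - real (K * L * m) * real \<beta> / real H\<bar> \<le> real L"
proof -
  have *: "\<bar>\<Sum>i<K. pass_error w \<beta> i l\<bar> \<le> 1" for l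
  proof (cases "\<beta> div W < m")
    case True
    have "(\<Sum>i<K. of_bool ((bitrev r i * V + w (\<beta> div W, l)) mod W < \<beta> mod W)) =
       (\<Sum>k<K. of_bool ((k * V + w (\<beta> div W, l)) mod (K * V) < \<beta> mod W) :: real)"
      unfolding K_def W_def[unfolded K_def] by (rule sum_bitrev)
    moreover have "\<bar>\<dots> - real (\<beta> mod W) / real V\<bar> \<le> 1"
      using pos_params by (intro lattice_count) (auto simp: W_def[symmetric] less_imp_le)
    moreover have "real K * (real (\<beta> mod W) / real W) = real (\<beta> mod W) / real V"
      using pos_params unfolding W_def by simp
    ultimately show ?thesis using True by (simp add: pass_error_def sum_subtractf)
  next
    case False
    then have "\<beta> = H" using assms unfolding H_def
      by (metis H_def assms le_antisym less_mult_imp_div_less linorder_not_less)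
    then have "\<beta> mod W = 0" by (simp add: H_def)
    then show ?thesis by (simp add: pass_error_def)
  qed
  have "(\<Sum>p<K * L. pass_error w \<beta> (p div L) (p mod L)) = (\<Sum>i<K. \<Sum>l<L. pass_error w \<beta> i l)"
    unfolding sum_lessThan_mult using L_pos by (intro sum.cong) auto
  also have "\<dots> = (\<Sum>l<L. \<Sum>i<K. pass_error w \<beta> i l)" by (rule sum.swap)
  also have "\<bar>\<dots>\<bar> \<le> (\<Sum>l<L. \<bar>\<Sum>i<K. pass_error w \<beta> i l\<bar>)" by (rule sum_abs)
  also have "\<dots> \<le> real (card {..<L}) * 1" by (intro sum_bounded_above *)
  finally show ?thesis using passes_count[OF assms, of w "K * L"] by simp
qed

end

section \<open>Pair counts of a block with random shifts\<close>

context block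
begin

text \<open>
Two points of the same cell with the same shift differ by a nonzero multiple of \<open>W / 2 ^ s\<close> if both
times are below \<open>2 ^ s\<close>, by \<open>bitrev_dvd\<close>.
\<close>

lemma shift_separation:
  assumes "i < t" "j < t" "t \<le> K" "i \<noteq> j" and near: "near H g (loc i c u) (loc j c u)"
  shows "W < 2 * t * g"
proof -
  obtain s where s: "t \<le> 2 ^ s" "2 ^ s < 2 * t" using power2_between[of t] assms by auto
  have "(2::nat) ^ s < 2 ^ Suc r" using s(2) assms(3) unfolding K_def by simp
  then have sr: "s \<le> r" by (simp only: power_strict_increasing_iff[of "2::nat"] one_less_numeral_iff semiring_norm less_Suc_eq_le)
  define G where "G = 2 ^ (r - s) * V"
  have GW: "G * 2 ^ s = W" unfolding G_def W_def K_def using sr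
    by (simp add: power_add[symmetric] mult.commute mult.left_commute)
  have "2 ^ (r - s) dvd bitrev r i" "2 ^ (r - s) dvd bitrev r j"
    using assms s sr by (auto intro!: bitrev_dvd)
  then have dv: "int G dvd int (bitrev r i * V)" "int G dvd int (bitrev r j * V)"
    unfolding G_def int_dvd_int_iff by (auto intro: mult_dvd_mono)
  have GWd: "int G dvd int W" unfolding GW[symmetric] by simp
  have GHd: "int G dvd int H" unfolding H_def using GWd by simp
  obtain n where n: "\<bar>int (loc i c u) - int (loc j c u) - n * int H\<bar> \<le> int g"
    using near near_iff_ex pos_params by blast
  let ?d = "int (loc i c u) - int (loc j c u) - n * int H"
  \<comment> \<open>the reductions modulo \<open>W\<close> and \<open>H\<close> change the difference by \<open>k W\<close>\<close>
  define k where "k = - ((int (bitrev r i * V) + int u) div int W) + (int (bitrev r j * V) + int u) div int W - n * int m"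
  have md: "int ((a + u) mod W) = int a + int u - (int a + int u) div int W * int W" for a
    by (simp add: zmod_int minus_div_mult_eq_mod)
  have d: "?d = int (bitrev r i * V) - int (bitrev r j * V) + k * int W"
    unfolding loc_def k_def H_def of_nat_add md by (simp add: algebra_simps)
  have "int G dvd ?d" unfolding d using dv GWd by (intro dvd_add dvd_diff dvd_mult)
  \<comment> \<open>otherwise \<open>K\<close> would divide the difference of two distinct values of the bit reversal\<close>
  moreover have "?d \<noteq> 0"
  proof
    assume "?d = 0"
    then have "int (bitrev r i * V) - int (bitrev r j * V) + k * int W = 0" using d by simp
    moreover have "int W = int K * int V" by (simp add: W_def)
    ultimately have "int V * (int (bitrev r i) - int (bitrev r j)) = int V * (- k * int K)"
      by (simp add: algebra_simps)
    moreover have "int V \<noteq> 0" using pos_params by simp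
    ultimately have "int (bitrev r i) - int (bitrev r j) = - k * int K"
      using mult_left_cancel by blast
    then have "int K dvd int (bitrev r i) - int (bitrev r j)" by simp
    moreover have "bitrev r i < K" "bitrev r j < K" using assms bitrev_less unfolding K_def by auto
    ultimately have "bitrev r i = bitrev r j"
      using zdvd_not_zless[of "\<bar>int (bitrev r i) - int (bitrev r j)\<bar>" "int K"] by force
    then show False using bitrev_inj[of i r j] assms unfolding K_def by auto
  qed
  ultimately have "int G \<le> \<bar>?d\<bar>" using zdvd_not_zless[of "\<bar>?d\<bar>" "int G"] by force
  then have "G \<le> g" using n by simp
  then have "2 ^ s * G < 2 * t * g" using s(2) pos_params
    by (intro mult_less_le_imp_less) (auto simp: G_def)
  then show ?thesis using GW by (simp add: mult.commute)
qed

text \<open>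
A uniform shift makes a point uniform in its cell, whatever \<open>i\<close> is; summed over the cells this is a
uniform density on the whole grid.
\<close>

lemma avg_loc:
  "(\<Sum>c<m. avg {..<W} (\<lambda>u. F (loc i c u))) = (\<Sum>z<H. F z) / real W"
proof -
  have "(\<Sum>u<W. F (loc i c u)) = (\<Sum>u<W. F (c * W + u))" for c
    unfolding loc_def by (rule sum_shift_mod)
  then show ?thesis
    unfolding avg_def H_def sum_lessThan_mult by (simp add: sum_divide_distrib)
qed

definition cells :: "(nat \<times> nat) set" where
  "cells = {..<m} \<times> {..<L}"

definition shifts :: "(nat \<times> nat \<Rightarrow> nat) set" where
  "shifts = PiE cells (\<lambda>_. {..<W})"

lemma finite_cells: "finite cells"
  by (simp add: cells_def)

lemma card_cells: "card cells = m * L"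
  by (simp add: cells_def)

lemma sum_cells: "(\<Sum>a\<in>cells. F a) = (\<Sum>c<m. \<Sum>l<L. F (c, l))"
  by (simp add: cells_def sum.cartesian_product)

lemma sum_cells': "(\<Sum>a\<in>cells. F a) = (\<Sum>l<L. \<Sum>c<m. F (c, l))"
  unfolding sum_cells by (rule sum.swap)

text \<open>
The factor \<open>2\<close> counts both orders of a pair.
\<close>

definition old_new :: "nat \<Rightarrow> (nat \<Rightarrow> nat) \<Rightarrow> nat \<Rightarrow> nat \<Rightarrow> nat \<times> nat \<Rightarrow> nat \<Rightarrow> real" where
  "old_new N0 Y t g a u = 2 * (\<Sum>i<t. \<Sum>n<N0. of_bool (near H g (loc i (fst a) u) (Y n)))"

definition new_new :: "nat \<Rightarrow> nat \<Rightarrow> nat \<times> nat \<Rightarrow> nat \<times> nat \<Rightarrow> nat \<Rightarrow> nat \<Rightarrow> real" where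
  "new_new t g a b u v = (\<Sum>i<t. \<Sum>j<t. of_bool (near H g (loc i (fst a) u) (loc j (fst b) v)))"

definition new_pairs :: "nat \<Rightarrow> (nat \<Rightarrow> nat) \<Rightarrow> nat \<Rightarrow> nat \<Rightarrow> (nat \<times> nat \<Rightarrow> nat) \<Rightarrow> real" where
  "new_pairs N0 Y t g w = (\<Sum>a\<in>cells. old_new N0 Y t g a (w a)) +
      (\<Sum>a\<in>cells. \<Sum>b\<in>cells - {a}. new_new t g a b (w a) (w b))"

lemma new_new_commute: "new_new t g a b u v = new_new t g b a v u"
  unfolding new_new_def by (subst sum.swap) (simp add: near_commute)

lemma near_loc_adjacent:
  assumes "g \<le> W" "c < m" "Y < H" "near H g (loc i c u) Y"
  shows "adjacent m c (Y div W)"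
  using near_adjacent[of g W "loc i c u" m Y] assms pos_params loc_less[OF assms(2), of i u] loc_div
  unfolding H_def by auto

text \<open>
All old points near a given one lie in three adjacent cells.
\<close>

lemma old_new_bound:
  assumes "g \<le> W" "t \<le> K" "a \<in> cells"
    and Y: "\<And>n. n < N0 \<Longrightarrow> Y n < H"
    and B: "\<And>d. d < m \<Longrightarrow> (\<Sum>n<N0. of_bool (Y n div W = d)) \<le> B"
  shows "0 \<le> old_new N0 Y t g a u \<and> old_new N0 Y t g a u \<le> 6 * real K * B"
proof
  show "0 \<le> old_new N0 Y t g a u" unfolding old_new_def by (intro mult_nonneg_nonneg sum_nonneg) auto
  have c: "fst a < m" using assms by (auto simp: cells_def)
  have B0: "0 \<le> B" using B[of 0] pos_params by (intro order_trans[OF _ B[of 0]] sum_nonneg) auto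
  have one: "(\<Sum>n<N0. of_bool (near H g (loc i (fst a) u) (Y n))) \<le> 3 * B" for i
  proof -
    let ?A = "{d. d < m \<and> adjacent m (fst a) d}"
    have "(\<Sum>n<N0. of_bool (near H g (loc i (fst a) u) (Y n))) \<le> (\<Sum>n<N0. \<Sum>d\<in>?A. of_bool (Y n div W = d) :: real)"
    proof (rule sum_mono)
      fix n assume n: "n \<in> {..<N0}"
      show "of_bool (near H g (loc i (fst a) u) (Y n)) \<le> (\<Sum>d\<in>?A. of_bool (Y n div W = d) :: real)"
      proof (cases "near H g (loc i (fst a) u) (Y n)")
        case True
        have "Y n div W \<in> ?A" 
          using near_loc_adjacent[OF assms(1) c _ True] Y[of n] n
          by (auto simp: H_def less_mult_imp_div_less)
        then have "of_bool (Y n div W = Y n div W) \<le> (\<Sum>d\<in>?A. of_bool (Y n div W = d) :: real)"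
          by (intro member_le_sum) auto
        then show ?thesis using True by simp
      qed (simp add: sum_nonneg)
    qed
    also have "\<dots> = (\<Sum>d\<in>?A. \<Sum>n<N0. of_bool (Y n div W = d))" by (rule sum.swap)
    also have "\<dots> \<le> real (card ?A) * B" by (intro sum_bounded_above B) auto
    also have "\<dots> \<le> 3 * B" using card_adjacent[of m "fst a"] B0 by (intro mult_right_mono) auto
    finally show ?thesis .
  qed
  have "old_new N0 Y t g a u \<le> 2 * (real (card {..<t}) * (3 * B))"
    unfolding old_new_def by (intro mult_left_mono sum_bounded_above one) auto
  also have "\<dots> = 6 * real t * B" by simp
  also have "\<dots> \<le> 6 * real K * B" using assms(2) B0 by (intro mult_right_mono) auto
  finally show "old_new N0 Y t g a u \<le> 6 * real K * B" .
qed

text \<open>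
Only the \<open>3 L\<close> shifts of three adjacent cells can interact with the shift of \<open>a\<close>.
\<close>

lemma new_new_bound:
  assumes "g \<le> W" "t \<le> K" "a \<in> cells"
  shows "0 \<le> (\<Sum>b\<in>cells - {a}. new_new t g a b u (w b)) \<and>
    (\<Sum>b\<in>cells - {a}. new_new t g a b u (w b)) \<le> 3 * real L * real K ^ 2"
proof
  show "0 \<le> (\<Sum>b\<in>cells - {a}. new_new t g a b u (w b))"
    unfolding new_new_def by (intro sum_nonneg) auto
  have c: "fst a < m" using assms by (auto simp: cells_def)
  let ?A = "{d. d < m \<and> adjacent m (fst a) d}"
  have "(\<Sum>b\<in>cells - {a}. new_new t g a b u (w b)) \<le> (\<Sum>b\<in>cells. new_new t g a b u (w b))"
    using finite_cells by (intro sum_mono2) (auto simp: new_new_def intro!: sum_nonneg)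
  also have "\<dots> \<le> (\<Sum>b\<in>cells. if fst b \<in> ?A then real K ^ 2 else 0)"
  proof (rule sum_mono)
    fix b assume b: "b \<in> cells"
    then have bm: "fst b < m" by (auto simp: cells_def)
    show "new_new t g a b u (w b) \<le> (if fst b \<in> ?A then real K ^ 2 else 0)"
    proof (cases "fst b \<in> ?A")
      case True
      have "new_new t g a b u (w b) \<le> real (card {..<t}) * (real (card {..<t}) * 1)"
        unfolding new_new_def by (intro sum_bounded_above) auto
      also have "\<dots> \<le> real K ^ 2" using assms(2) by (simp add: power2_eq_square mult_mono)
      finally show ?thesis using True by simp
    next
      case False
      have "\<not> near H g (loc i (fst a) u) (loc j (fst b) (w b))" for i j
        using near_loc_adjacent[OF assms(1) c loc_less[OF bm, of j "w b"], of i u] False bm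
        by (auto simp: loc_div)
      then show ?thesis using False by (simp add: new_new_def)
    qed
  qed
  also have "\<dots> = (\<Sum>c\<in>{..<m}. if c \<in> ?A then real L * real K ^ 2 else 0)"
    unfolding sum_cells by (intro sum.cong) auto
  also have "\<dots> = real (card ?A) * (real L * real K ^ 2)"
  proof -
    have "{..<m} \<inter> ?A = ?A" by auto
    then show ?thesis by (subst sum.inter_restrict[symmetric]) auto
  qed
  also have "\<dots> \<le> 3 * (real L * real K ^ 2)" using card_adjacent[of m "fst a"] by (intro mult_right_mono) auto
  finally show "(\<Sum>b\<in>cells - {a}. new_new t g a b u (w b)) \<le> 3 * real L * real K ^ 2" by simp
qed

lemma avg_old_new:
  assumes g: "2 * g + 1 \<le> H" 
  shows "(\<Sum>a\<in>cells. avg {..<W} (old_new N0 Y t g a)) =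
    2 * real N0 * real (t * L * m) * (real (2 * g + 1) / real H)"
proof -
  have one: "avg {..<W} (old_new N0 Y t g a) =
      2 * (\<Sum>i<t. \<Sum>n<N0. avg {..<W} (\<lambda>u. of_bool (near H g (loc i (fst a) u) (Y n))))" for a
    unfolding avg_mult_left[symmetric] avg_sum[symmetric] old_new_def[abs_def] ..
  have mean: "(\<Sum>c<m. avg {..<W} (\<lambda>u. of_bool (near H g (loc i c u) y))) = real (2 * g + 1) / real W" for i y
    using avg_loc[of "\<lambda>z. of_bool (near H g z y)" i] near_count[OF g, of y] by metis
  have "(\<Sum>a\<in>cells. avg {..<W} (old_new N0 Y t g a)) =
      (\<Sum>l<L. 2 * (\<Sum>i<t. \<Sum>n<N0. \<Sum>c<m. avg {..<W} (\<lambda>u. of_bool (near H g (loc i c u) (Y n)))))"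
    unfolding one sum_cells' fst_conv
    by (simp only: sum_distrib_left[symmetric] sum.swap[of _ _ "{..<m}"])
  also have "\<dots> = (\<Sum>l<L. 2 * (\<Sum>i<t. \<Sum>n<N0. real (2 * g + 1) / real W))"
    by (simp only: mean)
  also have "\<dots> = 2 * real N0 * real (t * L * m) * (real (2 * g + 1) / real H)"
    unfolding H_def using pos_params by (simp add: field_simps)
  finally show ?thesis .
qed

definition mean_near :: "nat \<Rightarrow> nat \<Rightarrow> nat \<Rightarrow> nat \<Rightarrow> nat \<Rightarrow> real" where
  "mean_near g i j c d = avg {..<W} (\<lambda>v. avg {..<W} (\<lambda>u. of_bool (near H g (loc i c u) (loc j d v))))"

lemma mean_near_nonneg: "0 \<le> mean_near g i j c d"
  unfolding mean_near_def avg_def by (intro divide_nonneg_nonneg sum_nonneg) auto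

text \<open>
The cell \<open>c\<close> varies and the second point is fixed, so this is again \<open>avg_loc\<close>.
\<close>

lemma sum_mean_near:
  assumes g: "2 * g + 1 \<le> H" 
  shows "(\<Sum>c<m. mean_near g i j c d) = real (2 * g + 1) / real W"
proof -
  have "{..<W} \<noteq> {}" using pos_params by (simp add: lessThan_empty_iff)
  have "(\<Sum>c<m. mean_near g i j c d) = avg {..<W} (\<lambda>v. \<Sum>c<m. avg {..<W} (\<lambda>u. of_bool (near H g (loc i c u) (loc j d v))))"
    unfolding mean_near_def by (rule avg_sum[symmetric])
  also have "\<dots> = avg {..<W} (\<lambda>v. real (2 * g + 1) / real W)"
  proof (rule avg_cong)
    fix v
    show "(\<Sum>c<m. avg {..<W} (\<lambda>u. of_bool (near H g (loc i c u) (loc j d v)))) = real (2 * g + 1) / real W"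
      using avg_loc[of "\<lambda>z. of_bool (near H g z (loc j d v))" i] near_count[OF g, of "loc j d v"] by metis
  qed
  also have "\<dots> = real (2 * g + 1) / real W"
    using \<open>{..<W} \<noteq> {}\<close> by (intro avg_const) auto
  finally show ?thesis .
qed

lemma avg_new_new:
  "avg {..<W} (\<lambda>v. avg {..<W} (\<lambda>u. new_new t g a b u v)) = (\<Sum>i<t. \<Sum>j<t. mean_near g i j (fst a) (fst b))"
  unfolding new_new_def avg_sum mean_near_def ..

text \<open>
The sum over all pairs of indices, the diagonal \<open>a = b\<close> included with two independent shifts, is exactly
\<open>Q\<close>.  For each \<open>b\<close>, the diagonal term is at most the sum over all cells for a fixed second index \<open>l\<close>
of \<open>a\<close>, which is the fraction \<open>1 / L\<close> of the sum over all \<open>a\<close>.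
\<close>

lemma avg_new_new_bounds:
  fixes t :: nat
  assumes g: "2 * g + 1 \<le> H" 
  defines "S \<equiv> (\<Sum>a\<in>cells. \<Sum>b\<in>cells - {a}. avg {..<W} (\<lambda>v. avg {..<W} (\<lambda>u. new_new t g a b u v)))"
    and "Q \<equiv> real (t * L * m) ^ 2 * (real (2 * g + 1) / real H)"
  shows "S \<le> Q" "Q - Q / real L \<le> S"
proof -
  define P where "P c d = (\<Sum>i<t. \<Sum>j<t. mean_near g i j c d)" for c d
  define q where "q = real (2 * g + 1) / real W"
  have P0: "0 \<le> P c d" for c d unfolding P_def by (intro sum_nonneg mean_near_nonneg)
  have sumP: "(\<Sum>c<m. P c d) = real t ^ 2 * q" for d
  proof -
    have "(\<Sum>c<m. P c d) = (\<Sum>i<t. \<Sum>j<t. \<Sum>c<m. mean_near g i j c d)"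
      unfolding P_def by (simp only: sum.swap[of _ _ "{..<m}"])
    then show ?thesis unfolding sum_mean_near[OF g] q_def by (simp add: power2_eq_square)
  qed
  have full: "(\<Sum>b\<in>cells. \<Sum>a\<in>cells. P (fst a) (fst b)) = Q"
  proof -
    have inner: "(\<Sum>a\<in>cells. P (fst a) d) = real L * (real t ^ 2 * q)" for d
      unfolding sum_cells' by (simp add: sumP)
    show ?thesis
      unfolding inner Q_def q_def H_def using pos_params by (simp add: card_cells power2_eq_square field_simps)
  qed
  have full': "(\<Sum>a\<in>cells. \<Sum>b\<in>cells. P (fst a) (fst b)) = Q"
    unfolding full[symmetric] by (rule sum.swap)
  have diag: "(\<Sum>a\<in>cells. P (fst a) (fst a)) \<le> Q / real L"
  proof -
    have "P c c \<le> real t ^ 2 * q" if "c < m" for c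
      unfolding sumP[of c, symmetric] using that P0 by (intro member_le_sum) auto
    then have "(\<Sum>a\<in>cells. P (fst a) (fst a)) \<le> real (card cells) * (real t ^ 2 * q)"
      by (intro sum_bounded_above) (auto simp: cells_def)
    also have "\<dots> = Q / real L"
      unfolding card_cells Q_def q_def H_def using pos_params L_pos by (simp add: power2_eq_square field_simps)
    finally show ?thesis .
  qed
  have "S = (\<Sum>a\<in>cells. (\<Sum>b\<in>cells. P (fst a) (fst b)) - P (fst a) (fst a))"
    unfolding S_def avg_new_new P_def[symmetric]
    using finite_cells by (intro sum.cong refl) (simp add: sum_diff1)
  then have S: "S = Q - (\<Sum>a\<in>cells. P (fst a) (fst a))"
    unfolding sum_subtractf full' .
  show "S \<le> Q" unfolding S using P0 by (simp add: sum_nonneg)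
  show "Q - Q / real L \<le> S" unfolding S using diag by simp
qed

lemma avg_new_pairs:
  "avg shifts (new_pairs N0 Y t g) = (\<Sum>a\<in>cells. avg {..<W} (old_new N0 Y t g a)) +
     (\<Sum>a\<in>cells. \<Sum>b\<in>cells - {a}. avg {..<W} (\<lambda>v. avg {..<W} (\<lambda>u. new_new t g a b u v)))"
proof -
  have ne: "finite {..<W}" "{..<W} \<noteq> {}" using pos_params by (auto simp: lessThan_empty_iff)
  show ?thesis
    unfolding new_pairs_def avg_add avg_sum shifts_def
    using ne finite_cells
    by (intro arg_cong2[of _ _ _ _ "(+)"] sum.cong refl avg_PiE_component avg_PiE_two_components) auto
qed

text \<open>
The test functions are the pair counts for all times \<open>t \<le> K\<close> and distances \<open>g \<le> W\<close>; times the number of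
coordinates, this gives the factor \<open>4 K L H\<close> under the root.
\<close>

lemma new_pairs_concentration:
  assumes "m \<ge> 3" 
    and Y: "\<And>n. n < N0 \<Longrightarrow> Y n < H"
    and B: "\<And>d. d < m \<Longrightarrow> (\<Sum>n<N0. of_bool (Y n div W = d)) \<le> B"
  defines "D \<equiv> 6 * real K * B + 6 * real L * real K ^ 2"
  shows "\<exists>w\<in>shifts. \<forall>t\<le>K. \<forall>g\<le>W.
     \<bar>new_pairs N0 Y t g w - (2 * real N0 * real (t * L * m) + real (t * L * m) ^ 2) * (real (2 * g + 1) / real H)\<bar>
       \<le> real (t * L * m) ^ 2 * (real (2 * g + 1) / real H) / real L + sqrt (4 * real (K * L * H)) * D"
proof -
  have ne: "finite {..<W}" "{..<W} \<noteq> {}" using pos_params by (auto simp: lessThan_empty_iff)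
  have B0: "0 \<le> B" using B[of 0] pos_params by (intro order_trans[OF _ B[of 0]] sum_nonneg) auto
  have D0: "D \<ge> 0" unfolding D_def using B0 by simp
  define T where "T = {..K} \<times> {..W}"
  define f where "f = (\<lambda>(t, g). new_pairs N0 Y t g)"
  have "\<exists>w\<in>PiE cells (\<lambda>_. {..<W}). \<forall>\<tau>\<in>T. (f \<tau> w - avg (PiE cells (\<lambda>_. {..<W})) (f \<tau>))\<^sup>2 \<le> real (card T) * real (card cells) * D\<^sup>2"
  proof (rule simultaneous_concentration[OF finite_cells ne])
    show "finite T" by (simp add: T_def)
    fix \<tau> w a u assume \<tau>: "\<tau> \<in> T" and w: "w \<in> PiE cells (\<lambda>_. {..<W})" and a: "a \<in> cells" and u: "u \<in> {..<W}"
    obtain t g where tg: "\<tau> = (t, g)" "t \<le> K" "g \<le> W" using \<tau> by (auto simp: T_def)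
    have "\<bar>new_pairs N0 Y t g (w(a := u)) - new_pairs N0 Y t g w\<bar> \<le> 6 * real K * B + 2 * (3 * real L * real K ^ 2)"
      unfolding new_pairs_def
      by (rule pair_functional_bounded_difference[where \<psi> = "new_new t g" and \<phi> = "old_new N0 Y t g", OF finite_cells a u w new_new_commute
            old_new_bound[OF tg(3,2) a Y B] new_new_bound[OF tg(3,2) a]])
    then show "\<bar>f \<tau> (w(a := u)) - f \<tau> w\<bar> \<le> D" by (simp add: f_def tg D_def)
  qed
  then obtain w where w: "w \<in> shifts" and
    wT: "\<And>\<tau>. \<tau> \<in> T \<Longrightarrow> (f \<tau> w - avg shifts (f \<tau>))\<^sup>2 \<le> real (card T) * real (card cells) * D\<^sup>2"
    unfolding shifts_def by blast
  have "(K + 1) * (W + 1) \<le> (2 * K) * (2 * W)" using pos_params by (intro mult_mono) auto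
  then have "card T * card cells \<le> (2 * K) * (2 * W) * (m * L)"
    unfolding card_cells T_def by (intro mult_right_mono) (auto simp: card_cartesian_product)
  then have "card T * card cells \<le> 4 * (K * L * H)" by (simp add: H_def mult_ac)
  then have cT: "real (card T) * real (card cells) \<le> 4 * real (K * L * H)"
    by (metis of_nat_le_iff of_nat_mult of_nat_numeral)
  show ?thesis
  proof (intro bexI[OF _ w] allI impI)
    fix t g assume t: "t \<le> K" and g: "g \<le> W"
    have gH: "2 * g + 1 \<le> H"
    proof -
      have "3 * W \<le> H" unfolding H_def using assms(1) by simp
      then show ?thesis using g pos_params by linarith
    qed
    let ?M = "avg shifts (new_pairs N0 Y t g)"
    have "(new_pairs N0 Y t g w - ?M)\<^sup>2 \<le> 4 * real (K * L * H) * D\<^sup>2"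
      using wT[of "(t, g)"] t g mult_right_mono[OF cT, of "D\<^sup>2"] by (auto simp: T_def f_def)
    then have "\<bar>new_pairs N0 Y t g w - ?M\<bar> \<le> sqrt (4 * real (K * L * H) * D\<^sup>2)"
      by (metis real_sqrt_abs real_sqrt_le_mono)
    also have "\<dots> = sqrt (4 * real (K * L * H)) * D" using D0 by (simp add: real_sqrt_mult)
    finally have "\<bar>new_pairs N0 Y t g w - ?M\<bar> \<le> sqrt (4 * real (K * L * H)) * D" .
    moreover have "?M \<le> (2 * real N0 * real (t * L * m) + real (t * L * m) ^ 2) * (real (2 * g + 1) / real H)"
      unfolding avg_new_pairs avg_old_new[OF gH] using avg_new_new_bounds(1)[OF gH, of t]
      by (simp only: distrib_right add_left_mono)
    moreover have "(2 * real N0 * real (t * L * m) + real (t * L * m) ^ 2) * (real (2 * g + 1) / real H)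
       - real (t * L * m) ^ 2 * (real (2 * g + 1) / real H) / real L \<le> ?M"
      unfolding avg_new_pairs avg_old_new[OF gH] using avg_new_new_bounds(2)[OF gH, of t]
      by (simp only: distrib_right)
    ultimately show "\<bar>new_pairs N0 Y t g w - (2 * real N0 * real (t * L * m) + real (t * L * m) ^ 2) * (real (2 * g + 1) / real H)\<bar>
       \<le> real (t * L * m) ^ 2 * (real (2 * g + 1) / real H) / real L + sqrt (4 * real (K * L * H)) * D"
      by linarith
  qed
qed

text \<open>
The pairs with the same index \<open>(c, l)\<close>, which \<open>new_pairs\<close> omits, are just the \<open>t L m\<close> pairs of a point
with itself, by \<open>shift_separation\<close>.
\<close>

lemma new_pairs_eq:
  assumes "t \<le> K" "2 * t * g \<le> W"
  shows "2 * (\<Sum>n<t * L * m. \<Sum>k<N0. of_bool (near H g (newpt w n) (Y k))) +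
      (\<Sum>n<t * L * m. \<Sum>k<t * L * m. of_bool (near H g (newpt w n) (newpt w k)))
     = new_pairs N0 Y t g w + real (t * L * m)"
proof -
  have "2 * (\<Sum>n<t * L * m. \<Sum>k<N0. of_bool (near H g (newpt w n) (Y k))) = (\<Sum>a\<in>cells. old_new N0 Y t g a (w a))"
  proof -
    have "(\<Sum>n<t * L * m. \<Sum>k<N0. of_bool (near H g (newpt w n) (Y k))) =
       (\<Sum>i<t. \<Sum>l<L. \<Sum>c<m. \<Sum>k<N0. of_bool (near H g (loc i c (w (c, l))) (Y k)) :: real)"
      by (rule sum_newpt_chunks)
    also have "\<dots> = (\<Sum>l<L. \<Sum>c<m. \<Sum>i<t. \<Sum>k<N0. of_bool (near H g (loc i c (w (c, l))) (Y k)))"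
      by (simp only: sum.swap[of _ _ "{..<t}"])
    finally show ?thesis unfolding old_new_def sum_cells' by (simp add: sum_distrib_left)
  qed
  moreover have "(\<Sum>n<t * L * m. \<Sum>k<t * L * m. of_bool (near H g (newpt w n) (newpt w k))) =
      (\<Sum>a\<in>cells. \<Sum>b\<in>cells. new_new t g a b (w a) (w b))"
  proof -
    have one: "(\<Sum>k<t * L * m. F (newpt w k)) = (\<Sum>b\<in>cells. \<Sum>j<t. F (loc j (fst b) (w b)))" for F :: "nat \<Rightarrow> real"
      unfolding sum_newpt_chunks sum_cells' by (simp add: sum.swap[of _ _ "{..<t}"])
    have "(\<Sum>n<t * L * m. \<Sum>k<t * L * m. of_bool (near H g (newpt w n) (newpt w k))) =
      (\<Sum>a\<in>cells. \<Sum>i<t. \<Sum>b\<in>cells. \<Sum>j<t. of_bool (near H g (loc i (fst a) (w a)) (loc j (fst b) (w b))) :: real)"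
      unfolding one[of "\<lambda>x. of_bool (near H g _ x)"] by (rule one)
    then show ?thesis unfolding new_new_def by (simp add: sum.swap[of _ "{..<t}" cells])
  qed
  moreover have "(\<Sum>a\<in>cells. \<Sum>b\<in>cells. new_new t g a b (w a) (w b)) =
     (\<Sum>a\<in>cells. \<Sum>b\<in>cells - {a}. new_new t g a b (w a) (w b)) + (\<Sum>a\<in>cells. new_new t g a a (w a) (w a))"
  proof -
    have "(\<Sum>b\<in>cells. new_new t g a b (w a) (w b)) = 
      (\<Sum>b\<in>cells - {a}. new_new t g a b (w a) (w b)) + new_new t g a a (w a) (w a)" if "a \<in> cells" for a
      using finite_cells that by (simp add: sum.remove[of cells a])
    then show ?thesis by (simp add: sum.distrib)
  qed
  moreover have "(\<Sum>a\<in>cells. new_new t g a a (w a) (w a)) = real (t * L * m)"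
  proof -
    have near_refl: "near H g X X" for X by (simp add: near_def)
    have "new_new t g a a u u = real t" for a u
    proof -
      have "new_new t g a a u u = (\<Sum>i<t. \<Sum>j<t. if j = i then 1 else 0)"
        unfolding new_new_def
      proof (intro sum.cong refl)
        fix i j assume "i \<in> {..<t}" "j \<in> {..<t}"
        then show "of_bool (near H g (loc i (fst a) u) (loc j (fst a) u)) = (if j = i then 1 else 0 :: real)"
          using shift_separation[of i t j g "fst a" u] assms near_refl by auto
      qed
      then show ?thesis by simp
    qed
    then show ?thesis by (simp add: card_cells)
  qed
  ultimately show ?thesis unfolding new_pairs_def by simp
qed

end

section \<open>Appending a block to a given set of points\<close>

definition count_below :: "(nat \<Rightarrow> real) \<Rightarrow> nat \<Rightarrow> real \<Rightarrow> real" where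
  "count_below z N a = (\<Sum>n<N. of_bool (z n < a))"

text \<open>
All ordered pairs, including those of a point with itself: a full double sum splits along a partition of the points.
\<close>

definition close_pairs :: "(nat \<Rightarrow> real) \<Rightarrow> nat \<Rightarrow> real \<Rightarrow> real" where
  "close_pairs z N \<delta> = (\<Sum>n<N. \<Sum>k<N. of_bool (dist_nearest_int (z n - z k) \<le> \<delta>))"

lemma count_below_cong: "(\<And>n. n < N \<Longrightarrow> z n = z' n) \<Longrightarrow> count_below z N a = count_below z' N a"
  unfolding count_below_def by (intro sum.cong) auto

lemma close_pairs_cong: "(\<And>n. n < N \<Longrightarrow> z n = z' n) \<Longrightarrow> close_pairs z N \<delta> = close_pairs z' N \<delta>"
  unfolding close_pairs_def by (intro sum.cong) auto

lemma close_pairs_mono: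
  assumes "M \<le> N"
  shows "close_pairs z M \<delta> \<le> close_pairs z N \<delta>"
proof -
  have "close_pairs z M \<delta> \<le> (\<Sum>n<M. \<Sum>k<N. of_bool (dist_nearest_int (z n - z k) \<le> \<delta>))"
    unfolding close_pairs_def using assms by (intro sum_mono sum_mono2) auto
  also have "\<dots> \<le> close_pairs z N \<delta>"
    unfolding close_pairs_def using assms by (intro sum_mono2 sum_nonneg) auto
  finally show ?thesis .
qed

context block
begin

definition extend :: "nat \<Rightarrow> (nat \<Rightarrow> nat) \<Rightarrow> (nat \<times> nat \<Rightarrow> nat) \<Rightarrow> nat \<Rightarrow> real" where
  "extend N Y w n = real (if n < N then Y n else newpt w (n - N)) / real H"

lemma extend_old: "n < N \<Longrightarrow> extend N Y w n = real (Y n) / real H"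
  by (simp add: extend_def)

lemma extend_new: "extend N Y w (N + n) = real (newpt w n) / real H"
  by (simp add: extend_def)

lemma count_below_extend:
  assumes "0 \<le> a"
  shows "count_below (extend N Y w) (N + n) a =
     count_below (extend N Y w) N a + (\<Sum>k<n. of_bool (newpt w k < nat \<lceil>a * real H\<rceil>))"
proof -
  have "real x / real H < a \<longleftrightarrow> x < nat \<lceil>a * real H\<rceil>" for x
    using pos_params assms by (simp add: divide_less_eq zless_nat_eq_int_zless less_ceiling_iff)
  then show ?thesis
    unfolding count_below_def sum_lessThan_add extend_new by simp
qed

text \<open>
The summand \<open>1\<close> is the error made when the threshold \<open>a\<close> is rounded up to the grid.
\<close>

lemma count_below_extend_discrepancy:
  assumes a: "0 \<le> a" "a \<le> 1" and n: "n \<le> H"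
    and E: "\<bar>(\<Sum>k<n. of_bool (newpt w k < nat \<lceil>a * real H\<rceil>)) - real n * real (nat \<lceil>a * real H\<rceil>) / real H\<bar> \<le> E"
    and old: "\<bar>count_below (extend N Y w) N a - a * real N\<bar> \<le> E0"
  shows "\<bar>count_below (extend N Y w) (N + n) a - a * real (N + n)\<bar> \<le> E0 + E + 1"
proof -
  let ?b = "real (nat \<lceil>a * real H\<rceil>)"
  have "0 \<le> a * real H" using a by simp
  then have "0 \<le> \<lceil>a * real H\<rceil>" by (simp add: le_ceiling_iff)
  then have b: "a * real H \<le> ?b" "?b \<le> a * real H + 1" using ceiling_correct[of "a * real H"] by auto
  have H: "real H > 0" using pos_params by simp
  have "real n * a \<le> real n * ?b / real H" using mult_left_mono[OF b(1), of "real n"] H by (simp add: field_simps)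
  moreover have "real n * ?b / real H \<le> real n * (a * real H + 1) / real H"
    using b(2) H by (intro divide_right_mono mult_left_mono) auto
  moreover have "real n * (a * real H + 1) / real H = real n * a + real n / real H" using H by (simp add: field_simps)
  moreover have "real n / real H \<le> 1" using n H by simp
  ultimately show ?thesis
    using E old unfolding count_below_extend[OF a(1)] by (simp add: abs_le_iff algebra_simps)
qed

lemma close_pairs_extend:
  assumes "0 \<le> \<delta>"
  defines "g \<equiv> nat \<lfloor>\<delta> * real H\<rfloor>"
  shows "close_pairs (extend N Y w) (N + n) \<delta> = close_pairs (extend N Y w) N \<delta> +
     (2 * (\<Sum>k<n. \<Sum>j<N. of_bool (near H g (newpt w k) (Y j))) +
      (\<Sum>k<n. \<Sum>j<n. of_bool (near H g (newpt w k) (newpt w j))))"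
proof -
  define c where "c x y = (of_bool (dist_nearest_int (extend N Y w x - extend N Y w y) \<le> \<delta>) :: real)" for x y
  have sum2: "(\<Sum>x<N + n. \<Sum>y<N + n. c x y) =
     (\<Sum>x<N. \<Sum>y<N. c x y) + (\<Sum>x<N. \<Sum>k<n. c x (N + k)) + ((\<Sum>k<n. \<Sum>y<N. c (N + k) y) + (\<Sum>k<n. \<Sum>j<n. c (N + k) (N + j)))"
    by (simp add: sum_lessThan_add[of _ N n] sum.distrib)
  have nn: "c (N + k) (N + j) = of_bool (near H g (newpt w k) (newpt w j))" for k j
    unfolding c_def extend_new g_def using pos_params assms by (simp add: dist_nearest_int_grid)
  have no: "c (N + k) y = of_bool (near H g (newpt w k) (Y y))" if "y < N" for k y
    unfolding c_def extend_new extend_old[OF that] g_def using pos_params assms by (simp add: dist_nearest_int_grid)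
  have on: "c y (N + k) = of_bool (near H g (newpt w k) (Y y))" if "y < N" for k y
    unfolding c_def extend_new extend_old[OF that] g_def using pos_params assms
    by (simp add: dist_nearest_int_grid near_commute)
  have "(\<Sum>x<N. \<Sum>k<n. c x (N + k)) = (\<Sum>x<N. \<Sum>k<n. of_bool (near H g (newpt w k) (Y x)))"
    using on by (intro sum.cong) auto
  also have "\<dots> = (\<Sum>k<n. \<Sum>x<N. of_bool (near H g (newpt w k) (Y x)))" by (rule sum.swap)
  finally have 1: "(\<Sum>x<N. \<Sum>k<n. c x (N + k)) = (\<Sum>k<n. \<Sum>x<N. of_bool (near H g (newpt w k) (Y x)))" .
  have 2: "(\<Sum>k<n. \<Sum>y<N. c (N + k) y) = (\<Sum>k<n. \<Sum>x<N. of_bool (near H g (newpt w k) (Y x)))"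
    using no by (intro sum.cong) auto
  show ?thesis
    unfolding close_pairs_def c_def[symmetric] sum2 1 2 nn by simp
qed

text \<open>
At the end of a chunk, the mean is \<open>2 \<delta> (M\<^sup>2 - N\<^sup>2)\<close> up to the rounding of \<open>2 \<delta>\<close> to
\<open>(2 g + 1) / H\<close> and the missing diagonal.  The condition \<open>L M \<le> H\<close> makes the first error at most
\<open>M / L\<close>.
\<close>

lemma chunk_pair_error:
  fixes N t :: nat and \<delta> :: real
  assumes t: "t \<le> K" and \<delta>: "0 \<le> \<delta>" "\<delta> * real m \<le> 1" "2 * \<delta> * real (t * L * m) \<le> real L"
    and M: "M = N + t * L * m" "real L * real M \<le> real H"
    and conc: "\<And>g. g \<le> W \<Longrightarrow> \<bar>new_pairs N Y t g w -
        (2 * real N * real (t * L * m) + real (t * L * m) ^ 2) * (real (2 * g + 1) / real H)\<bar>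
       \<le> real (t * L * m) ^ 2 * (real (2 * g + 1) / real H) / real L + real N / real L"
  shows "\<bar>close_pairs (extend N Y w) M \<delta> - close_pairs (extend N Y w) N \<delta> - real (M - N)
     - 2 * \<delta> * (real M ^ 2 - real N ^ 2)\<bar> \<le> (3 + 2 * \<delta> * real M) * real M / real L"
proof -
  define g where "g = nat \<lfloor>\<delta> * real H\<rfloor>"
  define n where "n = real (t * L * m)"
  define G where "G = real (2 * g + 1) / real H"
  have H: "real H > 0" and L: "real L > 0" using pos_params L_pos by auto
  have g: "real g \<le> \<delta> * real H" "\<delta> * real H \<le> real g + 1"
    unfolding g_def using \<delta>(1) H by auto
  have "\<delta> * real H = \<delta> * real m * real W" unfolding H_def by simp
  also have "\<dots> \<le> 1 * real W" using \<delta> by (intro mult_right_mono) auto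
  finally have gW: "g \<le> W" using g by (metis mult_1 of_nat_le_iff order_trans)
  have "2 * real t * real g \<le> 2 * real t * (\<delta> * real m * real W)"
    using g(1) unfolding H_def by (intro mult_left_mono) auto
  also have "\<dots> = (2 * \<delta> * real (t * L * m)) / real L * real W" using L by simp
  also have "\<dots> \<le> 1 * real W" using \<delta>(3) L by (intro mult_right_mono) auto
  finally have "real (2 * t * g) \<le> real W" by simp
  then have tg: "2 * t * g \<le> W" by (simp only: of_nat_le_iff)
  have MN: "real M = real N + n" "real (M - N) = n" unfolding M n_def by auto
  have n0: "n \<ge> 0" by (simp add: n_def)
  have diff: "close_pairs (extend N Y w) M \<delta> = close_pairs (extend N Y w) N \<delta> + (new_pairs N Y t g w + n)"
    unfolding M(1) close_pairs_extend[OF \<delta>(1)] g_def[symmetric] new_pairs_eq[OF t tg] n_def ..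
  have "(2 * (\<delta> * real H) - 1) / real H \<le> G" "G \<le> (2 * (\<delta> * real H) + 1) / real H"
    using g unfolding G_def by (auto intro!: divide_right_mono)
  then have G: "2 * \<delta> - 1 / real H \<le> G" "G \<le> 2 * \<delta> + 1 / real H"
    using H by (auto simp: diff_divide_distrib add_divide_distrib)
  have sq: "2 * real N * n + n ^ 2 = real M ^ 2 - real N ^ 2" unfolding MN by (simp add: power2_eq_square algebra_simps)
  have sq0: "0 \<le> real M ^ 2 - real N ^ 2" "real M ^ 2 - real N ^ 2 \<le> real M ^ 2" unfolding sq[symmetric] using n0 by auto (simp add: sq)
  have MH: "real M ^ 2 / real H \<le> real M / real L"
  proof -
    have "real M * (real L * real M) \<le> real M * real H" using M(2) by (intro mult_left_mono) auto
    then show ?thesis using H L by (simp add: field_simps power2_eq_square)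
  qed
  have MH1: "real M ^ 2 / real H \<le> real M"
  proof -
    have "real M / real L \<le> real M" using L_pos by (simp add: divide_le_eq mult_le_cancel_left1)
    then show ?thesis using MH by linarith
  qed
  have "\<bar>(real M ^ 2 - real N ^ 2) * (G - 2 * \<delta>)\<bar> \<le> real M ^ 2 * (1 / real H)"
    unfolding abs_mult using sq0 G by (intro mult_mono) auto
  then have e1: "\<bar>(real M ^ 2 - real N ^ 2) * G - 2 * \<delta> * (real M ^ 2 - real N ^ 2)\<bar> \<le> real M / real L"
    using MH by (simp add: algebra_simps)
  have "0 \<le> G" by (simp add: G_def)
  then have "n ^ 2 * G \<le> real M ^ 2 * (2 * \<delta> + 1 / real H)"
    using n0 G \<delta>(1) H unfolding MN(1) by (intro mult_mono power_mono) auto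
  also have "\<dots> \<le> (2 * \<delta> * real M + 1) * real M"
    using MH1 by (simp add: algebra_simps power2_eq_square)
  finally have e2: "n ^ 2 * G / real L \<le> (2 * \<delta> * real M + 1) * real M / real L"
    using L by (intro divide_right_mono) auto
  have e3: "real N / real L \<le> real M / real L" using L unfolding MN(1) using n0 by (intro divide_right_mono) auto
  have "\<bar>new_pairs N Y t g w - (real M ^ 2 - real N ^ 2) * G\<bar> \<le> n ^ 2 * G / real L + real N / real L"
    using conc[OF gW] unfolding n_def[symmetric] G_def[symmetric] sq .
  then have "\<bar>new_pairs N Y t g w - 2 * \<delta> * (real M ^ 2 - real N ^ 2)\<bar>
      \<le> (2 * \<delta> * real M + 1) * real M / real L + real M / real L + real M / real L"
    using e1 e2 e3 by linarith
  also have "\<dots> = (3 + 2 * \<delta> * real M) * real M / real L"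
    by (simp add: add_divide_distrib[symmetric] algebra_simps)
  finally show ?thesis unfolding diff MN(2) by simp
qed

text \<open>
Between two ends of chunks the number of close pairs is enclosed by its values at these times.  A chunk has
\<open>L m \<le> N / L\<close> points, so the enclosure costs no more than the error terms that are already present.
\<close>

lemma block_pair_error:
  fixes N n :: nat and \<delta> :: real
  assumes M: "M = N + n" "n \<le> K * L * m"
    and \<delta>: "0 \<le> \<delta>" "\<delta> * real M \<le> real L / 4" and N: "L * L * m \<le> N"
    and H: "real L * real (N + K * L * m) \<le> real H"
    and conc: "\<And>t g. t \<le> K \<Longrightarrow> g \<le> W \<Longrightarrow> \<bar>new_pairs N Y t g w -
        (2 * real N * real (t * L * m) + real (t * L * m) ^ 2) * (real (2 * g + 1) / real H)\<bar>
       \<le> real (t * L * m) ^ 2 * (real (2 * g + 1) / real H) / real L + real N / real L"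
  shows "\<bar>close_pairs (extend N Y w) M \<delta> - close_pairs (extend N Y w) N \<delta> - real (M - N)
     - 2 * \<delta> * (real M ^ 2 - real N ^ 2)\<bar> \<le> (7 + 14 * \<delta> * real M) * real M / real L"
proof -
  define C where "C j = close_pairs (extend N Y w) j \<delta>" for j
  define err where "err j = C j - C N - real (j - N) - 2 * \<delta> * (real j ^ 2 - real N ^ 2)" for j
  have L: "real L > 0" using L_pos by auto
  have step: "real L * real (L * m) \<le> real N" using N by (metis mult.assoc of_nat_le_iff of_nat_mult)
  have L1: "1 \<le> real L" using L_pos by simp
  have Lm: "real (L * m) \<le> real N / real L" using step L by (simp add: field_simps)
  have LmN: "L * m \<le> N" using N L_pos by (metis One_nat_def Suc_leI le_trans mult.assoc mult_le_mono1 nat_mult_1)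
  have chunk: "\<bar>err (N + t * L * m)\<bar> \<le> (3 + 2 * \<delta> * real (N + t * L * m)) * real (N + t * L * m) / real L"
    if t: "t \<le> K" "N + t * L * m \<le> 2 * M" for t
    unfolding err_def C_def
  proof (rule chunk_pair_error[OF t(1) \<delta>(1)])
    have le2: "\<delta> * real (N + t * L * m) \<le> real L / 2"
    proof -
      have "\<delta> * real (N + t * L * m) \<le> \<delta> * real (2 * M)" using t(2) \<delta>(1) by (intro mult_left_mono) (auto simp del: of_nat_add of_nat_mult)
      then show ?thesis using \<delta>(2) by simp
    qed
    have "\<delta> * real (t * L * m) \<le> \<delta> * real (N + t * L * m)" using \<delta>(1) by (intro mult_left_mono) auto
    then show "2 * \<delta> * real (t * L * m) \<le> real L" using le2 by linarith
    have "\<delta> * (real L * real m) \<le> \<delta> * real (N + t * L * m)"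
      using \<delta>(1) LmN by (intro mult_left_mono) (auto simp flip: of_nat_mult)
    moreover have "real L * (\<delta> * real m) = \<delta> * (real L * real m)" by simp
    ultimately have "real L * (\<delta> * real m) \<le> real L * 1" using le2 L by linarith
    then show "\<delta> * real m \<le> 1" using L by (simp only: mult_le_cancel_left_pos)
    have "t * L * m \<le> K * L * m" using t(1) by (intro mult_le_mono) auto
    then have "real (N + t * L * m) \<le> real (N + K * L * m)" by (simp only: of_nat_le_iff add_le_cancel_left)
    then have "real L * real (N + t * L * m) \<le> real L * real (N + K * L * m)" by (rule mult_left_mono) simp
    then show "real L * real (N + t * L * m) \<le> real H" using H by linarith
  qed (use conc t in auto)
  have NM: "N \<le> M" by (simp add: M)
  have widen: "(3 + 2 * \<delta> * real j) * real j / real L \<le> (6 + 8 * \<delta> * real M) * real M / real L" if "j \<le> 2 * M" for j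
  proof -
    have j: "real j \<le> 2 * real M" using that by (metis of_nat_le_iff of_nat_mult of_nat_numeral)
    have "(3 + 2 * \<delta> * real j) * real j \<le> (3 + 2 * \<delta> * (2 * real M)) * (2 * real M)"
      using \<delta>(1) j by (intro mult_mono add_mono mult_left_mono) auto
    then show ?thesis using L by (intro divide_right_mono) (auto simp: algebra_simps)
  qed
  show ?thesis
  proof (cases "n = K * L * m")
    case True
    have "\<bar>err M\<bar> \<le> (3 + 2 * \<delta> * real M) * real M / real L"
      using chunk[of K] unfolding M(1) True by simp
    also have "\<dots> \<le> (7 + 14 * \<delta> * real M) * real M / real L"
      using \<delta>(1) L by (intro divide_right_mono mult_right_mono add_mono) auto
    finally show ?thesis unfolding err_def C_def .
  next
    case False
    \<comment> \<open>\<open>t\<close> is the number of complete chunks\<close>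
    define t where "t = n div (L * m)"
    have Lm0: "L * m > 0" using L_pos pos_params by simp
    have "t < K" unfolding t_def using False M(2) Lm0 by (simp add: div_less_iff_less_mult mult.assoc)
    define M1 M2 where "M1 = N + t * L * m" and "M2 = N + (t + 1) * L * m"
    have "t * (L * m) \<le> n" unfolding t_def by simp
    then have M1: "M1 \<le> M" unfolding M1_def M by (simp add: mult.assoc)
    have "n < (t + 1) * (L * m)" unfolding t_def using Lm0 by (metis Suc_eq_plus1 dividend_less_div_times mult.commute mult_Suc_right)
    then have M2: "M \<le> M2" unfolding M2_def M by (simp add: algebra_simps)
    have M12: "M2 = M1 + L * m" unfolding M1_def M2_def by (simp add: algebra_simps)
    have M22: "M2 \<le> 2 * M" using M12 M1 LmN NM by linarith
    have NM1: "N \<le> M1" by (simp add: M1_def)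
    have gap: "real M2 - real M1 \<le> real M / real L"
    proof -
      have "real N / real L \<le> real M / real L" using NM L by (intro divide_right_mono) auto
      then show ?thesis using Lm unfolding M12 by simp
    qed
    have e1: "\<bar>err M1\<bar> \<le> (6 + 8 * \<delta> * real M) * real M / real L"
      using chunk[of t] widen[of M1] \<open>t < K\<close> M1 unfolding M1_def[symmetric] by simp
    have e2: "\<bar>err M2\<bar> \<le> (6 + 8 * \<delta> * real M) * real M / real L"
      using chunk[of "t + 1"] widen[of M2] \<open>t < K\<close> M22 unfolding M2_def[symmetric] by simp
    have sqgap: "2 * \<delta> * (real x ^ 2 - real y ^ 2) \<le> 6 * \<delta> * real M * (real M / real L)"
      if "y \<le> x" "real x - real y \<le> real M / real L" "real x + real y \<le> 3 * real M" for x y :: nat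
    proof -
      have "(real x - real y) * (real x + real y) \<le> (real M / real L) * (3 * real M)"
        using that L by (intro mult_mono) auto
      then have "2 * \<delta> * ((real x - real y) * (real x + real y)) \<le> 2 * \<delta> * ((real M / real L) * (3 * real M))"
        using \<delta>(1) by (intro mult_left_mono) auto
      moreover have "real x ^ 2 - real y ^ 2 = (real x - real y) * (real x + real y)"
        by (simp add: power2_eq_square algebra_simps)
      ultimately show ?thesis by (simp add: power2_eq_square algebra_simps)
    qed
    have r: "real M1 \<le> real M" "real M \<le> real M2" "real M2 \<le> 2 * real M" 
      using M1 M2 M22 by (auto simp flip: of_nat_mult)
    have s1: "2 * \<delta> * (real M ^ 2 - real M1 ^ 2) \<le> 6 * \<delta> * real M * (real M / real L)"
      using gap r M1 by (intro sqgap) auto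
    have s2: "2 * \<delta> * (real M2 ^ 2 - real M ^ 2) \<le> 6 * \<delta> * real M * (real M / real L)"
      using gap r M2 by (intro sqgap) auto
    have c: "C M1 \<le> C M" "C M \<le> C M2" unfolding C_def using M1 M2 by (auto intro: close_pairs_mono)
    have d: "real (M1 - N) = real M1 - real N" "real (M - N) = real M - real N" "real (M2 - N) = real M2 - real N"
      using NM1 NM M2 by (auto simp: of_nat_diff)
    have "\<bar>err M\<bar> \<le> (6 + 8 * \<delta> * real M) * real M / real L + 6 * \<delta> * real M * (real M / real L) + real M / real L"
      using e1 e2 s1 s2 c gap r unfolding err_def d by (simp only: right_diff_distrib abs_le_iff) linarith
    also have "\<dots> = (7 + 14 * \<delta> * real M) * real M / real L"
      by (simp add: add_divide_distrib[symmetric] algebra_simps)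
    finally show ?thesis unfolding err_def C_def .
  qed
qed

end

section \<open>Choice of the parameters of a block\<close>

text \<open>
What a finite initial part of the sequence must satisfy for the next block: a binary scale \<open>\<kappa>\<close> of \<open>N\<close>, a
dyadic grid of at most \<open>N powr (3 / 2)\<close> points, and logarithmic discrepancy.  The bound on the grid matters because
the number of tests in \<open>new_pairs_concentration\<close> is proportional to its size.
\<close>

definition admissible :: "(nat \<Rightarrow> real) \<Rightarrow> nat \<Rightarrow> nat \<Rightarrow> nat \<Rightarrow> bool" where
  "admissible z N \<kappa> h \<longleftrightarrow> 2 ^ \<kappa> \<le> N \<and> N < 2 ^ (\<kappa> + 1) \<and> 2 * h \<le> 3 * \<kappa> \<and>
     (\<forall>n<N. \<exists>k<2 ^ h. z n = real k / 2 ^ h) \<and>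
     (\<forall>a. 0 \<le> a \<and> a \<le> 1 \<longrightarrow> \<bar>count_below z N a - a * real N\<bar> \<le> 1 + 2 * log 2 (real N))"

text \<open>
The last two conditions control the discrepancy at all times of the block and the increment of the pair count for all
distances \<open>\<delta>\<close> of order \<open>1 / M\<close>.
\<close>

definition good_extension :: "nat \<Rightarrow> (nat \<Rightarrow> real) \<Rightarrow> nat \<Rightarrow> (nat \<Rightarrow> real) \<Rightarrow> nat \<Rightarrow> bool" where
  "good_extension q z N z' N' \<longleftrightarrow> (\<forall>n<N. z' n = z n) \<and> 2 ^ q * N \<le> N' \<and>
     (\<forall>M a. N \<le> M \<and> M \<le> N' \<and> 0 \<le> a \<and> a \<le> 1 \<longrightarrow> \<bar>count_below z' M a - a * real M\<bar> \<le> 7 * log 2 (real M)) \<and>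
     (\<forall>M \<delta>. N \<le> M \<and> M \<le> N' \<and> 0 \<le> \<delta> \<and> \<delta> * real M \<le> real q / 4 \<longrightarrow>
        \<bar>close_pairs z' M \<delta> - close_pairs z N \<delta> - real (M - N) - 2 * \<delta> * (real M ^ 2 - real N ^ 2)\<bar>
          \<le> (7 + 14 * \<delta> * real M) * real M / real q)"

text \<open>
The bound \<open>D\<close> of \<open>new_pairs_concentration\<close>, for \<open>K = 2 ^ (3 q + 1)\<close>, \<open>L = q\<close> and at most
\<open>2 * 4 ^ q + 4 \<kappa> + 6\<close> old points per cell.
\<close>

definition fluctuation_bound :: "nat \<Rightarrow> nat \<Rightarrow> real" where
  "fluctuation_bound q \<kappa> = 6 * 2 ^ (3 * q + 1) * (2 * 4 ^ q + 4 * real \<kappa> + 6) + 6 * real q * (2 ^ (3 * q + 1)) ^ 2"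

text \<open>
The three conditions say that the new grid stays small, that an unfinished block costs at most \<open>\<kappa>\<close> in discrepancy, and that
the fluctuations of the pair counts are at most \<open>N / q\<close>.
\<close>

definition large_level :: "nat \<Rightarrow> nat \<Rightarrow> bool" where
  "large_level q \<kappa> \<longleftrightarrow> 6 * q + 6 \<le> \<kappa> \<and> 2 ^ (3 * q + 1) * q \<le> \<kappa> \<and>
     (4 * 2 ^ (3 * q + 1) * real q ^ 3 * fluctuation_bound q \<kappa> ^ 2) ^ 2 \<le> 2 ^ \<kappa>"

text \<open>
\<open>fluctuation_bound\<close> is linear in \<open>\<kappa>\<close>, so the last condition compares a polynomial of degree \<open>4\<close> with
\<open>2 ^ \<kappa>\<close>.
\<close>

lemma eventually_large_level: "eventually (large_level q) sequentially"
proof -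
  define A B where "A = 4 * 2 ^ (3 * q + 1) * real q ^ 3"
    and "B = 6 * 2 ^ (3 * q + 1) * (2 * 4 ^ q + 10) + 6 * real q * (2 ^ (3 * q + 1)) ^ 2"
  have A0: "A \<ge> 0" and B0: "B \<ge> 0" by (auto simp: A_def B_def)
  have fb: "fluctuation_bound q \<kappa> \<le> B * (real \<kappa> + 1)" "0 \<le> fluctuation_bound q \<kappa>" for \<kappa>
  proof -
    have "2 * 4 ^ q + 4 * real \<kappa> + 6 \<le> (2 * 4 ^ q + 10) * (real \<kappa> + 1)" by (simp add: algebra_simps)
    then have "6 * 2 ^ (3 * q + 1) * (2 * 4 ^ q + 4 * real \<kappa> + 6) \<le> 6 * 2 ^ (3 * q + 1) * ((2 * 4 ^ q + 10) * (real \<kappa> + 1))"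
      by (intro mult_left_mono) auto
    moreover have "6 * real q * (2 ^ (3 * q + 1)) ^ 2 * 1 \<le> 6 * real q * (2 ^ (3 * q + 1)) ^ 2 * (real \<kappa> + 1)"
      by (intro mult_left_mono) auto
    ultimately show "fluctuation_bound q \<kappa> \<le> B * (real \<kappa> + 1)"
      unfolding fluctuation_bound_def B_def by (simp only: distrib_right mult.assoc)
    show "0 \<le> fluctuation_bound q \<kappa>" unfolding fluctuation_bound_def by simp
  qed
  have "((\<lambda>n. (real n + 1) ^ 4 / 2 ^ n) \<longlongrightarrow> 0) sequentially" by real_asymp
  then have "eventually (\<lambda>n. (real n + 1) ^ 4 / 2 ^ n < 1 / (A ^ 2 * B ^ 4 + 1)) sequentially"
    by (rule order_tendstoD) (use A0 B0 in \<open>simp add: add_nonneg_pos\<close>)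
  then have "eventually (\<lambda>\<kappa>. (A * fluctuation_bound q \<kappa> ^ 2) ^ 2 \<le> 2 ^ \<kappa>) sequentially"
  proof eventually_elim
    case (elim n)
    define x where "x = (real n + 1) ^ 4"
    have x: "x \<ge> 0" by (simp add: x_def)
    have C: "A ^ 2 * B ^ 4 + 1 > 0" using A0 B0 by (simp add: add_nonneg_pos)
    have "(A * fluctuation_bound q n ^ 2) ^ 2 \<le> (A * (B * (real n + 1)) ^ 2) ^ 2"
      using fb[of n] A0 by (intro power_mono mult_left_mono) auto
    also have "\<dots> = A ^ 2 * B ^ 4 * x" by (simp add: x_def power_mult_distrib flip: power_mult)
    also have "\<dots> \<le> (A ^ 2 * B ^ 4 + 1) * x" using x by (simp add: algebra_simps)
    also have "\<dots> \<le> 2 ^ n" using elim C unfolding x_def[symmetric] by (simp add: field_simps)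
    finally show ?case .
  qed
  moreover have "eventually (\<lambda>\<kappa>. 6 * q + 6 \<le> \<kappa>) sequentially" "eventually (\<lambda>\<kappa>. 2 ^ (3 * q + 1) * q \<le> \<kappa>) sequentially"
    by (rule eventually_ge_at_top)+
  ultimately show ?thesis unfolding large_level_def A_def by eventually_elim auto
qed

text \<open>
Here the parameters are balanced.  With \<open>m\<close> between \<open>N / (2 * 4 ^ q)\<close> and \<open>N / 4 ^ q\<close> a chunk of
\<open>q m\<close> points is at most \<open>N / q\<close>, and \<open>K = 2 * 8 ^ q\<close> passes for each of the \<open>q\<close> shifts make the number of points
grow by the factor \<open>2 ^ q\<close> that pays for the counting error \<open>q + 1\<close> of the complete block.
\<close>

lemma good_extension_exists:
  assumes q: "q \<ge> 1" and lv: "large_level q \<kappa>" and adm: "admissible z N \<kappa> h0"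
  shows "\<exists>z' N' \<kappa>' h'. admissible z' N' \<kappa>' h' \<and> good_extension q z N z' N'"
proof -
  have l6: "6 * q + 6 \<le> \<kappa>" and lK: "2 ^ (3 * q + 1) * q \<le> \<kappa>"
    and lD: "(4 * 2 ^ (3 * q + 1) * real q ^ 3 * fluctuation_bound q \<kappa> ^ 2) ^ 2 \<le> 2 ^ \<kappa>"
    using lv by (auto simp: large_level_def)
  have N: "2 ^ \<kappa> \<le> N" "N < 2 ^ (\<kappa> + 1)" and h0: "2 * h0 \<le> 3 * \<kappa>"
    and grid: "\<And>n. n < N \<Longrightarrow> \<exists>k<2 ^ h0. z n = real k / 2 ^ h0"
    and disc: "\<And>a. 0 \<le> a \<Longrightarrow> a \<le> 1 \<Longrightarrow> \<bar>count_below z N a - a * real N\<bar> \<le> 1 + 2 * log 2 (real N)"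
    using adm by (auto simp: admissible_def)
  \<comment> \<open>the new grid refines the old one and has at least \<open>q\<close> times as many points as the extended set\<close>
  define h where "h = max h0 (\<kappa> + 3 * q + 3)"
  define \<nu> where "\<nu> = h - (\<kappa> - 2 * q) - (3 * q + 1)"
  define m K V where "m = (2::nat) ^ (\<kappa> - 2 * q)" and "K = (2::nat) ^ (3 * q + 1)" and "V = (2::nat) ^ \<nu>"
  define W where "W = K * V"
  define H where "H = m * W"
  interpret block "\<kappa> - 2 * q" "3 * q + 1" \<nu> q m K V W H
    by unfold_locales (use q in \<open>auto simp: m_def K_def V_def W_def H_def\<close>)
  have h: "h0 \<le> h" "\<kappa> + 3 * q + 3 \<le> h" "2 * h \<le> 3 * \<kappa>" using h0 l6 by (auto simp: h_def max_def)
  have H2: "H = 2 ^ h"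
  proof -
    have "(\<kappa> - 2 * q) + ((3 * q + 1) + \<nu>) = h" unfolding \<nu>_def using h l6 by linarith
    then show ?thesis unfolding H_def W_def m_def K_def V_def by (metis power_add)
  qed
  have m4: "4 ^ q * m = 2 ^ \<kappa>"
  proof -
    have "(4::nat) ^ q = 2 ^ (2 * q)" by (simp add: power_mult)
    moreover have "2 * q + (\<kappa> - 2 * q) = \<kappa>" using l6 by linarith
    ultimately show ?thesis unfolding m_def by (metis power_add)
  qed
  have q2: "q \<le> 2 ^ q" by (simp add: less_imp_le)
  have q4: "q * q \<le> 4 ^ q" "q * 2 ^ q \<le> 4 ^ q"
  proof -
    have e: "(4::nat) ^ q = 2 ^ q * 2 ^ q" by (simp flip: power_mult_distrib)
    show "q * q \<le> 4 ^ q" "q * 2 ^ q \<le> 4 ^ q" unfolding e using q2 by (auto intro!: mult_le_mono)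
  qed
  have m3: "m \<ge> 3"
  proof -
    have "(2::nat) ^ 2 \<le> m" unfolding m_def using l6 by (intro power_increasing) auto
    then show ?thesis by simp
  qed
  have step: "q * q * m \<le> N"
    using mult_le_mono1[OF q4(1), of m] m4 N(1) by linarith
  have pow3: "(2::nat) ^ (3 * q) = 2 ^ q * 4 ^ q"
  proof -
    have "(2::nat) ^ (3 * q) = (2 ^ 3) ^ q" by (rule power_mult)
    also have "\<dots> = (2 * 4) ^ q" by simp
    also have "\<dots> = 2 ^ q * 4 ^ q" by (rule power_mult_distrib)
    finally show ?thesis .
  qed
  have Kqm: "K * q * m = 2 * (q * 2 ^ q) * 2 ^ \<kappa>"
    unfolding K_def m4[symmetric] by (simp add: pow3)
  define N' where "N' = N + K * q * m"
  have qN': "q * N' \<le> H"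
  proof -
    have "N' \<le> 2 * 2 ^ \<kappa> + 2 * (q * 2 ^ q) * 2 ^ \<kappa>" unfolding N'_def Kqm using N(2) by simp
    also have "\<dots> \<le> 2 * 4 ^ q * 2 ^ \<kappa> + 2 * 4 ^ q * 2 ^ \<kappa>"
      using q4(2) by (intro add_mono mult_le_mono) auto
    also have "\<dots> = 4 * 4 ^ q * 2 ^ \<kappa>" by simp
    finally have "q * N' \<le> 2 ^ q * (4 * 4 ^ q * 2 ^ \<kappa>)" using q2 by (intro mult_le_mono)
    also have "\<dots> = 2 ^ (\<kappa> + 3 * q + 2)"
      by (simp add: power_add pow3)
    also have "\<dots> \<le> H" unfolding H2 using h(2) by (intro power_increasing) auto
    finally show ?thesis .
  qed
  have N'H: "N' \<le> H" using qN' q by (metis One_nat_def le_trans mult_le_mono1 nat_mult_1)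
  have "\<exists>Y. \<forall>n<N. Y n < H \<and> z n = real (Y n) / real H"
  proof -
    have "\<exists>y. y < H \<and> z n = real y / real H" if nN: "n < N" for n
    proof -
      obtain k where k: "k < 2 ^ h0" "z n = real k / 2 ^ h0" using grid[OF nN] by blast
      have e: "(2::nat) ^ h = 2 ^ h0 * 2 ^ (h - h0)" using h(1) by (simp flip: power_add)
      have "k * 2 ^ (h - h0) < H" unfolding H2 e using k(1) by simp
      moreover have "z n = real (k * 2 ^ (h - h0)) / real H" unfolding H2 e k(2) by simp
      ultimately show ?thesis by blast
    qed
    then show ?thesis by metis
  qed
  then obtain Y where Y: "\<And>n. n < N \<Longrightarrow> Y n < H" "\<And>n. n < N \<Longrightarrow> z n = real (Y n) / real H" by blast
  have Npos: "real N > 0" using N(1) by (metis gr0I le_zero_eq of_nat_0_less_iff power_not_zero zero_neq_numeral)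
  have logN: "real \<kappa> \<le> log 2 (real N)" "log 2 (real N) \<le> real \<kappa> + 1"
  proof -
    have "(2::real) ^ \<kappa> \<le> real N" using N(1) by (metis of_nat_le_iff of_nat_numeral of_nat_power)
    then show "real \<kappa> \<le> log 2 (real N)" using Npos by (simp add: le_log_iff powr_realpow)
    have "real N \<le> 2 ^ (\<kappa> + 1)" using N(2) by (metis less_imp_le of_nat_le_iff of_nat_numeral of_nat_power)
    then have "real N \<le> 2 powr (real \<kappa> + 1)" by (simp add: powr_add powr_realpow)
    then show "log 2 (real N) \<le> real \<kappa> + 1" using Npos by (simp add: log_le_iff)
  qed
  define B where "B = 2 * 4 ^ q + 4 * real \<kappa> + 6"
  \<comment> \<open>the old discrepancy, applied at both ends of a cell, bounds the number of old points in it\<close>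
  have cell: "(\<Sum>n<N. of_bool (Y n div W = d)) \<le> B" if d: "d < m" for d
  proof -
    have m0: "real m > 0" and W0: "real W > 0" using pos_params by auto
    have below: "z n < real e / real m \<longleftrightarrow> Y n < e * W" if "n < N" for n e
    proof -
      have "z n < real e / real m \<longleftrightarrow> real (Y n) < real (e * W)"
        unfolding Y(2)[OF that] H_def using m0 W0 by (simp add: field_simps)
      then show ?thesis by (simp only: of_nat_less_iff)
    qed
    have "(\<Sum>n<N. of_bool (Y n div W = d)) =
      (\<Sum>n<N. of_bool (z n < real (d + 1) / real m) - of_bool (z n < real d / real m) :: real)"
    proof (rule sum.cong[OF refl])
      fix n assume n: "n \<in> {..<N}"
      have "Y n div W = d \<longleftrightarrow> d * W \<le> Y n \<and> Y n < (d + 1) * W"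
      proof -
        have "Y n div W = d \<longleftrightarrow> d \<le> Y n div W \<and> Y n div W < d + 1" by auto
        also have "\<dots> \<longleftrightarrow> d * W \<le> Y n \<and> Y n < (d + 1) * W"
          using pos_params by (simp only: less_eq_div_iff_mult_less_eq div_less_iff_less_mult)
        finally show ?thesis .
      qed
      moreover have "Y n < d * W \<Longrightarrow> Y n < (d + 1) * W" by simp
      ultimately show "of_bool (Y n div W = d) = (of_bool (z n < real (d + 1) / real m) - of_bool (z n < real d / real m) :: real)"
        using below[of n "d + 1"] below[of n d] n by (auto simp: not_less)
    qed
    also have "\<dots> = count_below z N (real (d + 1) / real m) - count_below z N (real d / real m)"
      unfolding count_below_def by (rule sum_subtractf)
    also have "\<dots> \<le> real (d + 1) / real m * real N - real d / real m * real N + 2 * (1 + 2 * log 2 (real N))"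
    proof -
      have "real (d + 1) / real m \<le> 1" "real d / real m \<le> 1" using d by auto
      then show ?thesis using disc[of "real (d + 1) / real m"] disc[of "real d / real m"] m0 by (simp add: abs_le_iff)
    qed
    also have "real (d + 1) / real m * real N - real d / real m * real N = real N / real m"
      by (simp add: add_divide_distrib distrib_right)
    also have "real N / real m \<le> 2 * 4 ^ q"
    proof -
      have "N \<le> 2 * (4 ^ q * m)" unfolding m4 using N(2) by simp
      then have "real N \<le> real (2 * (4 ^ q * m))" by (simp only: of_nat_le_iff)
      then show ?thesis using m0 by (simp add: divide_le_eq)
    qed
    finally show ?thesis using logN(2) by (simp add: B_def)
  qed
  define D where "D = 6 * real K * B + 6 * real q * real K ^ 2"
  have D: "D = fluctuation_bound q \<kappa>" by (simp add: D_def B_def fluctuation_bound_def K_def)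
  have D0: "D \<ge> 0" by (simp add: D_def B_def)
  obtain w where conc: "\<And>t g. t \<le> K \<Longrightarrow> g \<le> W \<Longrightarrow> \<bar>new_pairs N Y t g w -
        (2 * real N * real (t * q * m) + real (t * q * m) ^ 2) * (real (2 * g + 1) / real H)\<bar>
       \<le> real (t * q * m) ^ 2 * (real (2 * g + 1) / real H) / real q + sqrt (4 * real (K * q * H)) * D"
    using new_pairs_concentration[OF m3 Y(1) cell] unfolding D_def by blast
  have fluct: "sqrt (4 * real (K * q * H)) * D \<le> real N / real q"
  proof -
    define X where "X = 4 * real K * real q ^ 3 * D ^ 2"
    have X0: "X \<ge> 0" by (simp add: X_def)
    have "X ^ 2 \<le> 2 ^ \<kappa>" using lD unfolding X_def D K_def by simp
    moreover have "real H ^ 2 \<le> 2 ^ (3 * \<kappa>)"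
    proof -
      have "(2::real) ^ (2 * h) \<le> 2 ^ (3 * \<kappa>)" using h(3) by (intro power_increasing) auto
      then show ?thesis unfolding H2 by (simp add: power_mult[symmetric] mult.commute)
    qed
    \<comment> \<open>squares avoid the exponent \<open>3 / 2\<close> in the size of the grid\<close>
    ultimately have "X ^ 2 * real H ^ 2 \<le> 2 ^ \<kappa> * 2 ^ (3 * \<kappa>)" by (intro mult_mono) auto
    also have "\<dots> = ((2 ^ \<kappa>) ^ 2) ^ 2" by (simp flip: power_add power_mult)
    finally have "(X * real H) ^ 2 \<le> ((2 ^ \<kappa>) ^ 2) ^ 2" by (simp only: power_mult_distrib)
    then have "X * real H \<le> (2 ^ \<kappa>) ^ 2" by (rule power2_le_imp_le) simp
    also have "(2 ^ \<kappa>) ^ 2 \<le> real N ^ 2"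
    proof (rule power_mono)
      show "(2::real) ^ \<kappa> \<le> real N" using N(1) by (metis of_nat_le_iff of_nat_numeral of_nat_power)
    qed simp
    finally have XH: "X * real H \<le> real N ^ 2" .
    have "(real q * (sqrt (4 * real (K * q * H)) * D)) ^ 2 = X * real H"
    proof -
      have "sqrt (4 * real (K * q * H)) ^ 2 = 4 * real K * real q * real H" by simp
      then show ?thesis unfolding power_mult_distrib X_def by (simp only:) (simp add: power2_eq_square power3_eq_cube)
    qed
    then have "(real q * (sqrt (4 * real (K * q * H)) * D)) ^ 2 \<le> real N ^ 2" using XH by (simp only:)
    then have "real q * (sqrt (4 * real (K * q * H)) * D) \<le> real N" by (rule power2_le_imp_le) simp
    moreover have "real q > 0" using q by simp
    ultimately show ?thesis by (simp only: pos_le_divide_eq mult.commute)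
  qed
  define z' where "z' = extend N Y w"
  have old: "z' n = z n" if "n < N" for n unfolding z'_def using extend_old[OF that] Y(2)[OF that] by simp
  have NN': "N \<le> N'" by (simp add: N'_def)
  have growth: "2 ^ q * N \<le> N'"
  proof -
    have "2 ^ q * N \<le> 2 ^ q * (2 * 2 ^ \<kappa>)" using N(2) by (intro mult_le_mono) auto
    also have "\<dots> \<le> 2 * (q * 2 ^ q) * 2 ^ \<kappa>" using q by simp
    also have "\<dots> \<le> N'" unfolding N'_def Kqm by simp
    finally show ?thesis .
  qed
  have cb: "count_below z' N a = count_below z N a" for a by (rule count_below_cong) (rule old)
  have cp: "close_pairs z' N \<delta> = close_pairs z N \<delta>" for \<delta> by (rule close_pairs_cong) (rule old)
  have logN': "log 2 (real N') \<ge> log 2 (real N) + real q"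
  proof -
    have "real (2 ^ q * N) \<le> real N'" using growth by (simp only: of_nat_le_iff)
    then have "log 2 (real (2 ^ q * N)) \<le> log 2 (real N')" using Npos by (intro log_mono) auto
    moreover have "log 2 (real (2 ^ q * N)) = real q + log 2 (real N)"
      using Npos by (simp add: log_mult log_nat_power)
    ultimately show ?thesis by simp
  qed
  have ceil: "nat \<lceil>a * real H\<rceil> \<le> H" if "0 \<le> a" "a \<le> 1" for a :: real
  proof -
    have "a * real H \<le> real H" using that by (simp add: mult_left_le_one_le)
    then show ?thesis by (simp add: ceiling_le_iff nat_le_iff)
  qed
  have final_disc: "\<bar>count_below z' N' a - a * real N'\<bar> \<le> 1 + 2 * log 2 (real N')" if a: "0 \<le> a" "a \<le> 1" for a
  proof -
    have "\<bar>count_below z' N' a - a * real N'\<bar> \<le> (1 + 2 * log 2 (real N)) + real q + 1"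
      unfolding N'_def z'_def
    proof (rule count_below_extend_discrepancy[OF a])
      show "K * q * m \<le> H" using N'H by (simp add: N'_def)
      show "\<bar>(\<Sum>k<K * q * m. of_bool (newpt w k < nat \<lceil>a * real H\<rceil>)) -
          real (K * q * m) * real (nat \<lceil>a * real H\<rceil>) / real H\<bar> \<le> real q"
        by (rule complete_discrepancy[OF ceil[OF a]])
      show "\<bar>count_below (extend N Y w) N a - a * real N\<bar> \<le> 1 + 2 * log 2 (real N)"
        using disc[OF a] cb[of a] unfolding z'_def by simp
    qed
    also have "\<dots> \<le> 1 + 2 * log 2 (real N')" using logN' q by simp
    finally show ?thesis .
  qed
  have mid_disc: "\<bar>count_below z' M a - a * real M\<bar> \<le> 7 * log 2 (real M)"
    if M: "N \<le> M" "M \<le> N'" and a: "0 \<le> a" "a \<le> 1" for M a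
  proof -
    obtain n where n: "M = N + n" using M(1) le_iff_add by blast
    have n': "n \<le> K * q * m" using M(2) unfolding n N'_def by simp
    have "\<bar>count_below z' M a - a * real M\<bar> \<le> (1 + 2 * log 2 (real N)) + (real (K * q) + real (\<kappa> - 2 * q) + 1) + 1"
      unfolding n z'_def
    proof (rule count_below_extend_discrepancy[OF a])
      show "n \<le> H" using n' N'H by (simp add: N'_def)
      show "\<bar>(\<Sum>k<n. of_bool (newpt w k < nat \<lceil>a * real H\<rceil>)) -
          real n * real (nat \<lceil>a * real H\<rceil>) / real H\<bar> \<le> real (K * q) + real (\<kappa> - 2 * q) + 1"
        by (rule prefix_discrepancy[OF ceil[OF a] n'])
      show "\<bar>count_below (extend N Y w) N a - a * real N\<bar> \<le> 1 + 2 * log 2 (real N)"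
        using disc[OF a] cb[of a] unfolding z'_def by simp
    qed
    also have "\<dots> \<le> 3 + 2 * log 2 (real N) + 2 * real \<kappa>"
    proof -
      have "real (K * q) \<le> real \<kappa>" using lK unfolding K_def by (simp only: of_nat_le_iff)
      then show ?thesis by simp
    qed
    also have "\<dots> \<le> 7 * log 2 (real N)" using logN(1) l6 by simp
    also have "\<dots> \<le> 7 * log 2 (real M)" using M(1) Npos by simp
    finally show ?thesis .
  qed
  have pairs: "\<bar>close_pairs z' M \<delta> - close_pairs z N \<delta> - real (M - N) - 2 * \<delta> * (real M ^ 2 - real N ^ 2)\<bar>
          \<le> (7 + 14 * \<delta> * real M) * real M / real q"
    if M: "N \<le> M" "M \<le> N'" and \<delta>: "0 \<le> \<delta>" "\<delta> * real M \<le> real q / 4" for M \<delta>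
  proof -
    obtain n where n: "M = N + n" using M(1) le_iff_add by blast
    have n': "n \<le> K * q * m" using M(2) unfolding n N'_def by simp
    have "real q * real N' \<le> real H" using qN' by (metis of_nat_le_iff of_nat_mult)
    then show ?thesis
      unfolding cp[symmetric] z'_def
      by (intro block_pair_error[OF n n' \<delta> step]) (use conc fluct in \<open>force simp: N'_def\<close>)+
  qed
  obtain \<kappa>' where l': "2 ^ \<kappa>' \<le> N'" "N' < 2 ^ (\<kappa>' + 1)"
    using ex_power_ivl1[of 2 N'] NN' Npos by auto
  have "(2::nat) ^ \<kappa> < 2 ^ (\<kappa>' + 1)" using N(1) NN' l'(2) by linarith
  then have "\<kappa> < \<kappa>' + 1" by (rule power_less_imp_less_exp[rotated]) simp
  then have h': "2 * h \<le> 3 * \<kappa>'" using h(3) by linarith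
  have "\<exists>k<2 ^ h. z' n = real k / 2 ^ h" if "n < N'" for n
  proof -
    have "z' n = real (if n < N then Y n else newpt w (n - N)) / real H"
      by (simp only: z'_def extend_def)
    moreover have "real H = 2 ^ h" using H2 by simp
    moreover have "(if n < N then Y n else newpt w (n - N)) < H"
      using Y(1) newpt_less by simp
    ultimately have "z' n = real (if n < N then Y n else newpt w (n - N)) / 2 ^ h"
      "(if n < N then Y n else newpt w (n - N)) < 2 ^ h" using H2 by (simp_all only:)
    then show ?thesis by blast
  qed
  then have "admissible z' N' \<kappa>' h" unfolding admissible_def using l' h' final_disc by blast
  moreover have "good_extension q z N z' N'"
    unfolding good_extension_def using old growth mid_disc pairs by blast
  ultimately show ?thesis by blast
qed

section \<open>Chaining infinitely many blocks\<close>

text \<open>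
The starting point of the construction.
\<close>

lemma lattice_admissible: "admissible (\<lambda>n. real n / 2 ^ \<kappa>) (2 ^ \<kappa>) \<kappa> \<kappa>"
proof -
  have "\<bar>count_below (\<lambda>n. real n / 2 ^ \<kappa>) (2 ^ \<kappa>) a - a * 2 ^ \<kappa>\<bar> \<le> 1 + 2 * real \<kappa>"
    if a: "0 \<le> a" "a \<le> 1" for a :: real
  proof -
    define b where "b = nat \<lceil>a * 2 ^ \<kappa>\<rceil>"
    have "0 \<le> a * 2 ^ \<kappa>" using a by simp
    then have "0 \<le> \<lceil>a * 2 ^ \<kappa>\<rceil>" by (simp add: le_ceiling_iff)
    then have b: "a * 2 ^ \<kappa> \<le> real b" "real b \<le> a * 2 ^ \<kappa> + 1"
      unfolding b_def using ceiling_correct[of "a * 2 ^ \<kappa>"] by auto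
    have bN: "b \<le> 2 ^ \<kappa>"
    proof -
      have "a * 2 ^ \<kappa> \<le> (2::real) ^ \<kappa>" using a by (simp add: mult_left_le_one_le)
      then show ?thesis unfolding b_def by (simp add: ceiling_le_iff nat_le_iff)
    qed
    have "real n / 2 ^ \<kappa> < a \<longleftrightarrow> n < b" for n
      unfolding b_def using a by (simp add: divide_less_eq zless_nat_eq_int_zless less_ceiling_iff)
    then have "count_below (\<lambda>n. real n / 2 ^ \<kappa>) (2 ^ \<kappa>) a = real (min (2 ^ \<kappa>) b)"
      unfolding count_below_def using sum_of_bool_less[of b "2 ^ \<kappa>"] by simp
    then show ?thesis using b bN by (simp add: min_absorb2)
  qed
  then show ?thesis
    unfolding admissible_def by (auto simp: log_nat_power)
qed

text \<open>
Block number \<open>k\<close> uses the largest \<open>q \<le> max k 1\<close> whose threshold \<open>\<Lambda> q\<close> the binary scale \<open>\<kappa>\<close> of the current number of points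
has reached.  Since \<open>\<kappa>\<close> grows beyond each threshold, \<open>q\<close> tends to infinity.
\<close>

lemma exists_chained_blocks:
  "\<exists>(x :: nat \<Rightarrow> real) (N :: nat \<Rightarrow> nat) (q :: nat \<Rightarrow> nat).
     (\<forall>n. 0 \<le> x n \<and> x n < 1) \<and> (\<forall>k. k \<le> N k \<and> 0 < N k \<and> 2 * N k \<le> N (Suc k)) \<and>
     filterlim q at_top sequentially \<and> (\<forall>k. good_extension (q k) x (N k) x (N (Suc k)))"
proof -
  have "\<exists>\<Lambda>. \<forall>\<kappa>\<ge>\<Lambda>. large_level p \<kappa>" for p
    using eventually_large_level[of p] unfolding eventually_sequentially .
  then obtain \<Lambda> where \<Lambda>: "\<And>p \<kappa>. \<Lambda> p \<le> \<kappa> \<Longrightarrow> large_level p \<kappa>" by metis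
  define P where "P = (\<lambda>(k::nat) (z, N, \<kappa>, h). admissible z N \<kappa> h \<and> \<Lambda> 1 \<le> \<kappa>)"
  define Q where "Q = (\<lambda>(k::nat) (z, N, \<kappa>, h::nat) (z', N', \<kappa>'::nat, h'::nat). \<exists>q\<ge>1. good_extension q z N z' N' \<and>
     (\<forall>p. 1 \<le> p \<and> p \<le> k \<and> \<Lambda> p \<le> \<kappa> \<longrightarrow> p \<le> q))"
  have "\<exists>f. \<forall>k. P k (f k) \<and> Q k (f k) (f (Suc k))"
  proof (rule dependent_nat_choice)
    show "\<exists>s. P 0 s"
      using lattice_admissible[of "\<Lambda> 1"] by (intro exI[of _ "(\<lambda>n. real n / 2 ^ \<Lambda> 1, 2 ^ \<Lambda> 1, \<Lambda> 1, \<Lambda> 1)"]) (simp add: P_def)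
    fix s k assume Ps: "P k s"
    obtain z N \<kappa> h where s: "s = (z, N, \<kappa>, h)" by (cases s)
    have adm: "admissible z N \<kappa> h" and \<kappa>: "\<Lambda> 1 \<le> \<kappa>" using Ps by (auto simp: P_def s)
    \<comment> \<open>the bound \<open>max k 1\<close> only serves to make the set finite\<close>
    define S where "S = {p. 1 \<le> p \<and> p \<le> max k 1 \<and> \<Lambda> p \<le> \<kappa>}"
    have S: "finite S" "1 \<in> S" using \<kappa> by (auto simp: S_def)
    define q where "q = Max S"
    have "q \<in> S" unfolding q_def using S by (intro Max_in) auto
    then have q: "q \<ge> 1" "\<Lambda> q \<le> \<kappa>" by (auto simp: S_def)
    obtain z' N' \<kappa>' h' where ext: "admissible z' N' \<kappa>' h'" "good_extension q z N z' N'"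
      using good_extension_exists[OF q(1) \<Lambda>[OF q(2)] adm] by blast
    have "N \<le> 2 ^ q * N" by simp
    then have "(2::nat) ^ \<kappa> < 2 ^ (\<kappa>' + 1)"
      using ext adm unfolding admissible_def good_extension_def by linarith
    then have "\<kappa> < \<kappa>' + 1" by (rule power_less_imp_less_exp[rotated]) simp
    then have "P (Suc k) (z', N', \<kappa>', h')" using ext(1) \<kappa> by (simp add: P_def)
    moreover have "p \<le> q" if "1 \<le> p" "p \<le> k" "\<Lambda> p \<le> \<kappa>" for p
      unfolding q_def using S(1) that by (intro Max_ge) (auto simp: S_def)
    then have "Q k s (z', N', \<kappa>', h')" unfolding Q_def s using q(1) ext(2) by auto
    ultimately show "\<exists>s'. P (Suc k) s' \<and> Q k s s'" by blast
  qed
  then obtain f where f: "\<And>k. P k (f k)" "\<And>k. Q k (f k) (f (Suc k))" by blast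
  define z N \<kappa> h where "z k = fst (f k)" and "N k = fst (snd (f k))" and "\<kappa> k = fst (snd (snd (f k)))"
    and "h k = snd (snd (snd (f k)))" for k
  have adm: "admissible (z k) (N k) (\<kappa> k) (h k)" for k
    using f(1)[of k] by (simp add: P_def z_def N_def \<kappa>_def h_def case_prod_unfold)
  have "\<forall>k. \<exists>q\<ge>1. good_extension q (z k) (N k) (z (Suc k)) (N (Suc k)) \<and>
     (\<forall>p. 1 \<le> p \<and> p \<le> k \<and> \<Lambda> p \<le> \<kappa> k \<longrightarrow> p \<le> q)"
    using f(2) by (simp add: Q_def z_def N_def \<kappa>_def h_def case_prod_unfold)
  then obtain q where q1: "\<And>k. q k \<ge> 1" and ext: "\<And>k. good_extension (q k) (z k) (N k) (z (Suc k)) (N (Suc k))"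
    and qmax: "\<And>k p. 1 \<le> p \<Longrightarrow> p \<le> k \<Longrightarrow> \<Lambda> p \<le> \<kappa> k \<Longrightarrow> p \<le> q k" by metis
  have Npos: "0 < N k" for k using adm[of k] by (metis admissible_def gr0I le_zero_eq power_not_zero zero_neq_numeral)
  have dbl: "2 * N k \<le> N (Suc k)" for k
  proof -
    have "(2::nat) ^ 1 \<le> 2 ^ q k" using q1[of k] by (intro power_increasing) auto
    then have "2 * N k \<le> 2 ^ q k * N k" by simp
    then show ?thesis using ext[of k] unfolding good_extension_def by linarith
  qed
  have N2: "2 ^ k \<le> N k" for k
  proof (induction k)
    case 0
    show ?case using Npos[of 0] by simp
  next
    case (Suc k)
    then show ?case using dbl[of k] by simp
  qed
  have Nk: "k < N k" for k using N2[of k] less_exp[of k] by linarith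
  have mono: "N k \<le> N j" if "k \<le> j" for k j
    by (rule lift_Suc_mono_le[OF _ that]) (use dbl in \<open>metis le_trans mult_2 le_add1\<close>)
  have stable: "z (k + j) n = z k n" if "n < N k" for k j n
  proof (induction j)
    case (Suc j)
    have "n < N (k + j)" using that mono[of k "k + j"] by simp
    then have "z (Suc (k + j)) n = z (k + j) n" using ext[of "k + j"] by (auto simp: good_extension_def)
    then show ?case using Suc by simp
  qed simp
  \<comment> \<open>block \<open>n\<close> starts after more than \<open>n\<close> points, so the \<open>n\<close>-th point is already final\<close>
  define x where "x n = z n n" for n
  have xz: "x n = z k n" if "n < N k" for n k
  proof (cases "k \<le> n")
    case True
    then show ?thesis using stable[OF that, of "n - k"] by (simp add: x_def)
  next
    case False
    then show ?thesis using stable[OF Nk[of n], of "k - n"] by (simp add: x_def)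
  qed
  have range: "0 \<le> x n \<and> x n < 1" for n
  proof -
    obtain k where "k < 2 ^ h n" "x n = real k / 2 ^ h n"
      using adm[of n] Nk[of n] unfolding admissible_def x_def by blast
    then show ?thesis by (auto simp: of_nat_less_numeral_power_cancel_iff)
  qed
  have "eventually (\<lambda>k. p \<le> q k) sequentially" for p
    unfolding eventually_sequentially
  proof (intro exI[of _ "max p (\<Lambda> p)"] allI impI)
    fix k assume k: "max p (\<Lambda> p) \<le> k"
    have "(2::nat) ^ k < 2 ^ (\<kappa> k + 1)" using N2[of k] adm[of k] unfolding admissible_def by linarith
    then have "k < \<kappa> k + 1" by (rule power_less_imp_less_exp[rotated]) simp
    then show "p \<le> q k" using k qmax[of p k] by (cases "p = 0") auto
  qed
  then have qlim: "filterlim q at_top sequentially" by (simp add: filterlim_at_top)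
  have "good_extension (q k) x (N k) x (N (Suc k))" for k
  proof -
    have cb: "count_below (z (Suc k)) M a = count_below x M a" if "M \<le> N (Suc k)" for M a
      by (rule count_below_cong) (use xz that less_le_trans in metis)
    have cp1: "close_pairs (z (Suc k)) M \<delta> = close_pairs x M \<delta>" if "M \<le> N (Suc k)" for M \<delta>
      by (rule close_pairs_cong) (use xz that less_le_trans in metis)
    have cp0: "close_pairs (z k) (N k) \<delta> = close_pairs x (N k) \<delta>" for \<delta>
      by (rule close_pairs_cong) (use xz in metis)
    show ?thesis using ext[of k] unfolding good_extension_def by (simp add: cb cp1 cp0)
  qed
  then show ?thesis using range Nk Npos dbl qlim by (metis less_imp_le)
qed

section \<open>Limits of the two statistics\<close>

definition pair_error :: "(nat \<Rightarrow> real) \<Rightarrow> nat \<Rightarrow> real \<Rightarrow> real" where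
  "pair_error x M \<delta> = close_pairs x M \<delta> - real M - 2 * \<delta> * real M ^ 2"

text \<open>
The sequence is shifted by one because its indices start at \<open>1\<close>, whereas finite parts are indexed by \<open>{..<M}\<close>.
\<close>

lemma pair_correlation_eq:
  assumes "s > 0" "M \<ge> 1"
  shows "pair_correlation s (\<lambda>n. x (n - 1)) M = 2 * s + pair_error x M (s / real M) / real M"
proof -
  define \<delta> where "\<delta> = s / real M"
  have \<delta>: "0 \<le> \<delta>" using assms by (simp add: \<delta>_def)
  have zero: "dist_nearest_int 0 \<le> \<delta>" using \<delta> unfolding dist_nearest_int_le_iff by (intro exI[of _ 0]) simp
  let ?P = "\<lambda>n k. n \<noteq> k \<and> dist_nearest_int (x n - x k) \<le> \<delta>"
  have "{(n, m). n \<in> {1..M} \<and> m \<in> {1..M} \<and> n \<noteq> m \<and> dist_nearest_int (x (n - 1) - x (m - 1)) \<le> \<delta>}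
     = map_prod Suc Suc ` {p \<in> {..<M} \<times> {..<M}. ?P (fst p) (snd p)}" (is "?L = _ ` ?R")
  proof (intro equalityI subsetI)
    fix p assume "p \<in> ?L"
    then show "p \<in> map_prod Suc Suc ` ?R"
      by (intro image_eqI[of _ _ "(fst p - 1, snd p - 1)"]) auto
  next
    fix p assume "p \<in> map_prod Suc Suc ` ?R"
    then show "p \<in> ?L" by auto
  qed
  moreover have "inj_on (map_prod Suc Suc) ?R" by (auto simp: inj_on_def)
  ultimately have "card ?L = card ?R" by (simp add: card_image)
  also have "real (card ?R) = (\<Sum>p\<in>{..<M} \<times> {..<M}. of_bool (?P (fst p) (snd p)))"
    by (simp add: Int_def)
  also have "\<dots> = (\<Sum>n<M. \<Sum>k<M. of_bool (?P n k))"
    unfolding sum.cartesian_product case_prod_unfold ..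
  also have "\<dots> = (\<Sum>n<M. \<Sum>k<M. of_bool (dist_nearest_int (x n - x k) \<le> \<delta>) - (if k = n then 1 else 0))"
    using zero by (intro sum.cong) auto
  also have "\<dots> = close_pairs x M \<delta> - real M"
    unfolding close_pairs_def sum_subtractf by simp
  finally have "pair_correlation s (\<lambda>n. x (n - 1)) M = (close_pairs x M \<delta> - real M) / real M"
    unfolding pair_correlation_def \<delta>_def by simp
  also have "\<dots> = 2 * s + pair_error x M \<delta> / real M"
    using assms unfolding pair_error_def \<delta>_def by (simp add: field_simps power2_eq_square)
  finally show ?thesis by (simp add: \<delta>_def)
qed

lemma star_discrepancy_le:
  assumes "M \<ge> 1" "\<And>n. 0 \<le> x n" "\<And>a. 0 \<le> a \<Longrightarrow> a \<le> 1 \<Longrightarrow> \<bar>count_below x M a - a * real M\<bar> \<le> E"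
  shows "star_discrepancy (\<lambda>n. x (n - 1)) M \<le> E / real M"
  unfolding star_discrepancy_def
proof (rule cSUP_least)
  fix a :: real assume a: "a \<in> {0..<1}"
  have "(\<Sum>n=1..M. indicator {0..<a} (x (n - 1))) = (\<Sum>n<M. indicator {0..<a} (x n) :: real)"
    by (rule sum.reindex_bij_witness[of _ Suc "\<lambda>n. n - 1"]) auto
  also have "\<dots> = count_below x M a"
    unfolding count_below_def using assms(2) by (intro sum.cong) (auto simp: indicator_def)
  finally have "\<bar>1 / real M * (\<Sum>n=1..M. indicator {0..<a} (x (n - 1))) - a\<bar> = \<bar>(count_below x M a - a * real M) / real M\<bar>"
    using assms(1) by (simp add: field_simps)
  also have "\<dots> \<le> E / real M"
    using assms(3)[of a] a by (simp add: divide_right_mono)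
  finally show "\<bar>1 / real M * (\<Sum>n=1..M. indicator {0..<a} (x (n - 1))) - a\<bar> \<le> E / real M" .
qed simp

lemma halving_recursion_tendsto_0:
  fixes b r :: "nat \<Rightarrow> real"
  assumes b: "\<And>k. 0 \<le> b k" and step: "\<And>k. b (Suc k) \<le> b k / 2 + r k" and r: "r \<longlonglongrightarrow> 0"
  shows "b \<longlonglongrightarrow> 0"
proof (rule LIMSEQ_I)
  fix \<epsilon> :: real assume \<epsilon>: "\<epsilon> > 0"
  then obtain K where K: "\<And>k. k \<ge> K \<Longrightarrow> r k \<le> \<epsilon> / 4"
    using LIMSEQ_D[OF r, of "\<epsilon> / 4"] by (force simp: abs_less_iff)
  have bound: "b (K + j) \<le> b K / 2 ^ j + \<epsilon> / 2" for j
  proof (induction j)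
    case (Suc j)
    have "b (K + Suc j) \<le> b (K + j) / 2 + r (K + j)" using step[of "K + j"] by simp
    also have "\<dots> \<le> (b K / 2 ^ j + \<epsilon> / 2) / 2 + \<epsilon> / 4" using Suc K[of "K + j"] by (intro add_mono divide_right_mono) auto
    finally show ?case by (simp add: field_simps)
  qed (use \<epsilon> in simp)
  have "(\<lambda>j. b K * (1 / 2) ^ j) \<longlonglongrightarrow> b K * 0" by (intro tendsto_intros LIMSEQ_power_zero) auto
  then have "(\<lambda>j. b K / 2 ^ j) \<longlonglongrightarrow> 0" by (simp add: power_one_over)
  then have "eventually (\<lambda>j. b K / 2 ^ j < \<epsilon> / 2) sequentially"
    using \<epsilon> by (intro order_tendstoD(2)) auto
  then have "\<exists>J. \<forall>j\<ge>J. b K / 2 ^ j < \<epsilon> / 2" by (simp only: eventually_sequentially)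
  then obtain J where J: "\<And>j. j \<ge> J \<Longrightarrow> b K / 2 ^ j < \<epsilon> / 2" by blast
  have "b k < \<epsilon>" if "k \<ge> K + J" for k
  proof -
    have eq: "K + (k - K) = k" and le: "J \<le> k - K" using that by auto
    show ?thesis using bound[of "k - K"] J[OF le] unfolding eq by linarith
  qed
  then show "\<exists>no. \<forall>n\<ge>no. norm (b n - 0) < \<epsilon>" using b by (intro exI[of _ "K + J"]) auto
qed

lemma pair_error_trivial:
  assumes "0 \<le> \<delta>" "\<delta> * real M \<le> s"
  shows "\<bar>pair_error x M \<delta>\<bar> \<le> (real M + 1 + 2 * s) * real M"
proof -
  have "close_pairs x M \<delta> \<le> real (card {..<M}) * (real (card {..<M}) * 1)"
    unfolding close_pairs_def by (intro sum_bounded_above) auto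
  moreover have "0 \<le> close_pairs x M \<delta>" unfolding close_pairs_def by (intro sum_nonneg) auto
  moreover have "\<delta> * real M * real M \<le> s * real M" using assms by (intro mult_right_mono) auto
  moreover have "0 \<le> \<delta> * real M * real M" using assms by simp
  ultimately show ?thesis unfolding pair_error_def by (simp add: algebra_simps power2_eq_square abs_le_iff)
qed

lemma block_index:
  fixes N :: "nat \<Rightarrow> nat"
  assumes "\<And>k. k \<le> N k" "N j \<le> M"
  shows "\<exists>k\<ge>j. N k \<le> M \<and> M < N (Suc k)"
proof (rule ccontr)
  assume neg: "\<not> ?thesis"
  have "N (j + i) \<le> M" for i
  proof (induction i)
    case (Suc i)
    then show ?case using neg by (metis add_Suc_right le_add1 not_le)
  qed (use assms in simp)
  from this[of "Suc M"] show False using assms(1)[of "j + Suc M"] by linarith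
qed

text \<open>
For fixed \<open>s\<close>, once \<open>q k \<ge> 4 s\<close>, the relative error at the end of a block is at most half of the one at its
beginning, as the number of points at least doubles, plus \<open>c / q k\<close>.  A distance \<open>s / M\<close> inside a block is
at most \<open>s / N k\<close>, so the estimate at the beginning of the block has to hold for all distances up to \<open>s / N k\<close>.
\<close>

lemma chained_blocks_pair_error:
  fixes N q :: "nat \<Rightarrow> nat"
  assumes N: "\<And>k. k \<le> N k" "\<And>k. 2 * N k \<le> N (Suc k)" "\<And>k. 0 < N k"
    and q: "filterlim q at_top sequentially"
    and err: "\<And>k M \<delta>. N k \<le> M \<Longrightarrow> M \<le> N (Suc k) \<Longrightarrow> 0 \<le> \<delta> \<Longrightarrow> \<delta> * real M \<le> real (q k) / 4 \<Longrightarrow>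
       \<bar>pair_error x M \<delta> - pair_error x (N k) \<delta>\<bar> \<le> (7 + 14 * \<delta> * real M) * real M / real (q k)"
    and s: "s > 0"
  shows "(\<lambda>M. pair_error x M (s / real M) / real M) \<longlonglongrightarrow> 0"
proof -
  define c where "c = 7 + 14 * s"
  have qr: "filterlim (\<lambda>k. real (q k)) at_top sequentially"
    using q by (rule filterlim_compose[OF filterlim_real_sequentially])
  have r0: "(\<lambda>k. c / real (q k)) \<longlonglongrightarrow> 0"
    by (rule tendsto_divide_0[OF tendsto_const filterlim_at_top_imp_at_infinity[OF qr]])
  have "eventually (\<lambda>k. real (q k) \<ge> 4 * s) sequentially"
    using qr by (simp add: filterlim_at_top)
  then obtain k0 where k0: "\<And>k. k \<ge> k0 \<Longrightarrow> real (q k) \<ge> 4 * s"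
    unfolding eventually_sequentially by blast
  have err': "\<bar>pair_error x M \<delta>\<bar> \<le> \<bar>pair_error x (N k) \<delta>\<bar> + c / real (q k) * real M"
    if "k \<ge> k0" "N k \<le> M" "M \<le> N (Suc k)" "0 \<le> \<delta>" "\<delta> * real M \<le> s" for k M \<delta>
  proof -
    have "\<bar>pair_error x M \<delta> - pair_error x (N k) \<delta>\<bar> \<le> (7 + 14 * \<delta> * real M) * real M / real (q k)"
      using that k0[OF that(1)] by (intro err) auto
    also have "\<dots> \<le> c * real M / real (q k)"
      unfolding c_def using that by (intro divide_right_mono mult_right_mono) auto
    finally show ?thesis by simp
  qed
  \<comment> \<open>\<open>b j\<close> bounds the relative error at the start of block \<open>k0 + j\<close>; it starts with the trivial bound\<close>
  define b where "b = rec_nat (real (N k0) + 1 + 2 * s) (\<lambda>j y. y / 2 + c / real (q (k0 + j)))"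
  have b0: "b 0 = real (N k0) + 1 + 2 * s" and bS: "\<And>j. b (Suc j) = b j / 2 + c / real (q (k0 + j))"
    by (simp_all add: b_def)
  have c0: "c > 0" using s by (simp add: c_def)
  have bnn: "0 \<le> b j" for j
  proof (induction j)
    case (Suc j)
    then show ?case unfolding bS using c0 by simp
  qed (use s in \<open>simp add: b0\<close>)
  have blim: "b \<longlonglongrightarrow> 0"
    by (rule halving_recursion_tendsto_0[where r = "\<lambda>j. c / real (q (k0 + j))"])
      (use bnn bS r0 LIMSEQ_ignore_initial_segment[OF r0, of k0] in \<open>auto simp: add.commute\<close>)
  have main: "\<bar>pair_error x (N (k0 + j)) \<delta>\<bar> \<le> b j * real (N (k0 + j))"
    if "0 \<le> \<delta>" "\<delta> * real (N (k0 + j)) \<le> s" for j \<delta>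
    using that
  proof (induction j)
    case 0
    then show ?case using pair_error_trivial[of \<delta> "N k0" s x] by (simp add: b0)
  next
    case (Suc j)
    let ?k = "k0 + j"
    have NN: "2 * real (N ?k) \<le> real (N (Suc ?k))" using N(2)[of ?k] by (metis of_nat_le_iff of_nat_mult of_nat_numeral)
    then have le: "N ?k \<le> N (Suc ?k)" using N(2)[of ?k] by linarith
    have "\<delta> * real (N ?k) \<le> \<delta> * real (N (Suc ?k))" using Suc.prems(1) le by (intro mult_left_mono) auto
    then have "\<bar>pair_error x (N ?k) \<delta>\<bar> \<le> b j * real (N ?k)" using Suc by simp
    also have "\<dots> \<le> b j * (real (N (Suc ?k)) / 2)" using NN bnn by (intro mult_left_mono) auto
    finally have "\<bar>pair_error x (N ?k) \<delta>\<bar> \<le> b j / 2 * real (N (Suc ?k))" by simp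
    moreover have "\<bar>pair_error x (N (Suc ?k)) \<delta>\<bar> \<le> \<bar>pair_error x (N ?k) \<delta>\<bar> + c / real (q ?k) * real (N (Suc ?k))"
      using Suc.prems le by (intro err') auto
    ultimately show ?case unfolding bS by (simp add: distrib_right)
  qed
  show ?thesis
  proof (rule LIMSEQ_I)
    fix \<epsilon> :: real assume \<epsilon>: "\<epsilon> > 0"
    have "(\<lambda>j. b j + c / real (q (k0 + j))) \<longlonglongrightarrow> 0 + 0"
      using blim LIMSEQ_ignore_initial_segment[OF r0, of k0] by (intro tendsto_add) (auto simp: add.commute)
    then obtain J where J: "\<And>j. j \<ge> J \<Longrightarrow> b j + c / real (q (k0 + j)) < \<epsilon>"
      using LIMSEQ_D[of "\<lambda>j. b j + c / real (q (k0 + j))" 0 \<epsilon>] \<epsilon> by (force simp: abs_less_iff)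
    show "\<exists>no. \<forall>M\<ge>no. norm (pair_error x M (s / real M) / real M - 0) < \<epsilon>"
    proof (intro exI[of _ "N (k0 + J)"] allI impI)
      fix M assume M: "N (k0 + J) \<le> M"
      then obtain k where k: "k \<ge> k0 + J" "N k \<le> M" "M < N (Suc k)" using block_index[of N, OF N(1)] by blast
      have Mp: "real M > 0" using M N(3)[of "k0 + J"] by simp
      define j where "j = k - k0"
      have j: "k = k0 + j" "j \<ge> J" using k(1) by (auto simp: j_def)
      have "s / real M * real (N k) \<le> s / real M * real M" using k(2) s Mp by (intro mult_left_mono) auto
      then have "\<bar>pair_error x (N k) (s / real M)\<bar> \<le> b j * real (N k)"
        unfolding j(1) using s Mp by (intro main) auto
      also have "\<dots> \<le> b j * real M" using k(2) bnn by (intro mult_left_mono) auto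
      finally have "\<bar>pair_error x (N k) (s / real M)\<bar> \<le> b j * real M" .
      moreover have "\<bar>pair_error x M (s / real M)\<bar> \<le> \<bar>pair_error x (N k) (s / real M)\<bar> + c / real (q k) * real M"
        using k s Mp by (intro err') auto
      ultimately have "\<bar>pair_error x M (s / real M)\<bar> \<le> (b j + c / real (q (k0 + j))) * real M"
        unfolding j(1) by (simp add: distrib_right)
      also have "\<dots> < \<epsilon> * real M" using J[OF j(2)] Mp by (intro mult_strict_right_mono)
      finally show "norm (pair_error x M (s / real M) / real M - 0) < \<epsilon>" using Mp by (simp add: divide_less_eq)
    qed
  qed
qed

theorem theorem1p1:
  shows "\<exists>x :: nat \<Rightarrow> real.
           (\<forall>n\<ge>1. x n \<in> {0..<1}) \<and>
           (\<exists>C>0. \<forall>N\<ge>2. star_discrepancy x N \<le> C * (ln (real N) / real N)) \<and>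
           poissonian_pair_correlation x"
proof -
  obtain x :: "nat \<Rightarrow> real" and N q :: "nat \<Rightarrow> nat" where range: "\<And>n. 0 \<le> x n \<and> x n < 1"
    and N: "\<And>k. k \<le> N k" "\<And>k. 0 < N k" "\<And>k. 2 * N k \<le> N (Suc k)"
    and q: "filterlim q at_top sequentially" and ext: "\<And>k. good_extension (q k) x (N k) x (N (Suc k))"
    using exists_chained_blocks by blast
  \<comment> \<open>the summand \<open>real (N 0)\<close> absorbs the finitely many times before the first block\<close>
  define C where "C = 7 + real (N 0)"
  have disc: "\<bar>count_below x M a - a * real M\<bar> \<le> C * log 2 (real M)" if M: "M \<ge> 2" and a: "0 \<le> a" "a \<le> 1" for M a
  proof -
    have l1: "1 \<le> log 2 (real M)" using M by (simp add: le_log_iff)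
    show ?thesis
    proof (cases "N 0 \<le> M")
      case True
      then obtain k where "N k \<le> M" "M < N (Suc k)" using block_index[of N, OF N(1)] by blast
      then have "\<bar>count_below x M a - a * real M\<bar> \<le> 7 * log 2 (real M)"
        using ext[of k] a unfolding good_extension_def by simp
      also have "\<dots> \<le> C * log 2 (real M)" using l1 by (intro mult_right_mono) (auto simp: C_def)
      finally show ?thesis .
    next
      case False
      have "count_below x M a \<le> real (card {..<M}) * 1"
        unfolding count_below_def by (intro sum_bounded_above) auto
      moreover have "0 \<le> count_below x M a" unfolding count_below_def by (intro sum_nonneg) auto
      moreover have "0 \<le> a * real M" "a * real M \<le> real M" using a by (auto simp: mult_left_le_one_le)
      ultimately have "\<bar>count_below x M a - a * real M\<bar> \<le> real M" by (simp add: abs_le_iff)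
      also have "\<dots> \<le> C * 1" using False by (simp add: C_def)
      also have "\<dots> \<le> C * log 2 (real M)" using l1 by (intro mult_left_mono) (auto simp: C_def)
      finally show ?thesis .
    qed
  qed
  define y where "y = (\<lambda>n. x (n - 1))"
  have "star_discrepancy y M \<le> (C / ln 2) * (ln (real M) / real M)" if "M \<ge> 2" for M
    using star_discrepancy_le[of M x, OF _ _ disc[OF that]] that range by (simp add: y_def log_def)
  moreover have "C / ln 2 > 0" by (simp add: C_def add_pos_nonneg)
  moreover have "poissonian_pair_correlation y"
    unfolding poissonian_pair_correlation_def
  proof (intro allI impI)
    fix s :: real assume s: "s > 0"
    have err: "\<bar>pair_error x M \<delta> - pair_error x (N k) \<delta>\<bar> \<le> (7 + 14 * \<delta> * real M) * real M / real (q k)"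
      if "N k \<le> M" "M \<le> N (Suc k)" "0 \<le> \<delta>" "\<delta> * real M \<le> real (q k) / 4" for k M \<delta>
    proof -
      have "pair_error x M \<delta> - pair_error x (N k) \<delta> =
          close_pairs x M \<delta> - close_pairs x (N k) \<delta> - real (M - N k) - 2 * \<delta> * (real M ^ 2 - real (N k) ^ 2)"
        using that(1) by (simp add: pair_error_def of_nat_diff algebra_simps)
      then show ?thesis using ext[of k] that unfolding good_extension_def by simp
    qed
    have "(\<lambda>M. 2 * s + pair_error x M (s / real M) / real M) \<longlonglongrightarrow> 2 * s + 0"
      by (intro tendsto_add tendsto_const chained_blocks_pair_error[OF N(1,3,2) q err s])
    moreover have "eventually (\<lambda>M. 2 * s + pair_error x M (s / real M) / real M = pair_correlation s y M) sequentially"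
      using eventually_ge_at_top[of "1::nat"]
      unfolding y_def by eventually_elim (rule pair_correlation_eq[OF s, symmetric])
    ultimately show "(\<lambda>M. pair_correlation s y M) \<longlonglongrightarrow> 2 * s"
      by (simp add: tendsto_cong)
  qed
  ultimately show ?thesis using range by (intro exI[of _ y]) (auto simp: y_def)
qed

end
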